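(* Let $M$ be a loopless matroid on $E=\{0,\dots,n\}$ of rank $d+1$, and let $A_1,\dots,A_d$ be nonempty subsets of $E$. Then \[M\wedge H_{A_1}\wedge\cdots\wedge H_{A_d}=U_{1,E}\iff \{A_1,\dots,A_d\}\text{ satisfies }\operatorname{DHR}(M).\] Consequently, \[\int_M h_{A_1}(M)\cdots h_{A_d}(M)=\begin{cases}1&\text{if }\{A_1,\dots,A_d\}\text{ satisfies }\operatorname{DHR}(M),\\0&\text{otherwise.}\end{cases}\]
   Context: For nonempty $S\subseteq E$, $H_S$ is the matroid on $E$ with bases $\{E\setminus i: i\in S\}$. $M\wedge N$ is the matroid on $E$ whose spanning sets are $\{S\cap S': S\text{ spanning in }M,\ S'\text{ spanning in }N\}$; $U_{1,E}$ is the uniform matroid of rank $1$ on $E$. The family $\{A_1,\dots,A_d\}$ satisfies the dragon Hall–Rado condition $\operatorname{DHR}(M)$ if $\operatorname{rk}_M(\bigcup_{j\in J}A_j)\ge|J|+1$ for every nonempty $J\subseteq\{1,\dots,d\}$. The Chow ring $A^\bullet(M)=\mathbb R[x_F: F\text{ nonempty proper flat}]/(\langle x_Fx_{F'}: F,F'\text{ incomparable}\rangle+\langle\sum_{F\ni i}x_F-\sum_{F\ni j}x_F\rangle)$, with degree map $\int_M:A^d(M)\to\mathbb R$ given by $\int_M x_{F_1}\cdots x_{F_d}=1$ for maximal chains of nonempty proper flats. For nonempty $S\subseteq E$, $h_S(M)=\alpha-\sum_{G}x_G\in A^1(M)$, where $G$ ranges over proper flats containing $S$ and $\alpha=\sum_{F\ni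 i}x_F$ for any $i\in E$ (equivalently, in the Feichtner–Yuzvinsky variables, $h_S(M)=-\sum_{G\supseteq S}z_G$ over all flats $G\supseteq S$ including $E$, with $z_E=-\alpha$). *)

theory Defs
  imports Complex_Main "HOL-Library.Poly_Mapping"
begin

definition matroid_bases :: "nat set \<Rightarrow> nat set set \<Rightarrow> bool" where
  "matroid_bases E B \<longleftrightarrow> finite E \<and> B \<noteq> {} \<and> (\<forall>b\<in>B. b \<subseteq> E) \<and>
     (\<forall>b1\<in>B. \<forall>b2\<in>B. \<forall>x\<in>b1 - b2. \<exists>y\<in>b2 - b1. insert y (b1 - {x}) \<in> B)"

definition mrank :: "nat set set \<Rightarrow> nat set \<Rightarrow> nat" where
  "mrank B S = Max ((\<lambda>b. card (b \<inter> S)) ` B)"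

definition loopless :: "nat set \<Rightarrow> nat set set \<Rightarrow> bool" where
  "loopless E B \<longleftrightarrow> (\<forall>e\<in>E. mrank B {e} = 1)"

definition is_flat :: "nat set \<Rightarrow> nat set set \<Rightarrow> nat set \<Rightarrow> bool" where
  "is_flat E B F \<longleftrightarrow> F \<subseteq> E \<and> (\<forall>e\<in>E - F. mrank B (insert e F) > mrank B F)"

definition spanning_sets :: "nat set \<Rightarrow> nat set set \<Rightarrow> nat set set" where
  "spanning_sets E B = {S. S \<subseteq> E \<and> (\<exists>b\<in>B. b \<subseteq> S)}"

definition H_bases :: "nat set \<Rightarrow> nat set \<Rightarrow> nat set set" where
  "H_bases E S = {E - {i} | i. i \<in> S}"

definition U1_bases :: "nat set \<Rightarrow> nat set set" where
  "U1_bases E = {{i} | i. i \<in> E}"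

text \<open>The wedge M \<and> N, described by its family of spanning sets.\<close>
definition wedge_sp :: "nat set set \<Rightarrow> nat set set \<Rightarrow> nat set set" where
  "wedge_sp X Y = {S \<inter> S' | S S'. S \<in> X \<and> S' \<in> Y}"

fun iter_wedge_sp :: "nat set \<Rightarrow> nat set set \<Rightarrow> (nat \<Rightarrow> nat set) \<Rightarrow> nat \<Rightarrow> nat set set" where
  "iter_wedge_sp E B A 0 = spanning_sets E B"
| "iter_wedge_sp E B A (Suc k) =
     wedge_sp (iter_wedge_sp E B A k) (spanning_sets E (H_bases E (A (Suc k))))"

definition DHR :: "nat set set \<Rightarrow> (nat \<Rightarrow> nat set) \<Rightarrow> nat \<Rightarrow> bool" where
  "DHR B A d \<longleftrightarrow> (\<forall>J. J \<subseteq> {1..d} \<and> J \<noteq> {} \<longrightarrow> mrank B (\<Union>j\<in>J. A j) \<ge> card J + 1)"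

type_synonym cpoly = "(nat set \<Rightarrow>\<^sub>0 nat) \<Rightarrow>\<^sub>0 real"

definition xvar :: "nat set \<Rightarrow> cpoly" where
  "xvar F = Poly_Mapping.single (Poly_Mapping.single F 1) 1"

definition ideal_gen :: "cpoly set \<Rightarrow> cpoly set" where
  "ideal_gen G = {(\<Sum>g\<in>G'. r g * g) | G' r. finite G' \<and> G' \<subseteq> G}"

definition proper_flats :: "nat set \<Rightarrow> nat set set \<Rightarrow> nat set set" where
  "proper_flats E B = {F. is_flat E B F \<and> F \<noteq> {} \<and> F \<noteq> E}"

definition chow_ideal :: "nat set \<Rightarrow> nat set set \<Rightarrow> cpoly set" where
  "chow_ideal E B = ideal_gen
     ({xvar F * xvar F' | F F'. F \<in> proper_flats E B \<and> F' \<in> proper_flats E B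
                               \<and> \<not> F \<subseteq> F' \<and> \<not> F' \<subseteq> F}
      \<union> {(\<Sum>F\<in>{F\<in>proper_flats E B. i \<in> F}. xvar F) - (\<Sum>F\<in>{F\<in>proper_flats E B. j \<in> F}. xvar F)
          | i j. i \<in> E \<and> j \<in> E})"

definition flat_chain :: "nat set \<Rightarrow> nat set set \<Rightarrow> nat set set \<Rightarrow> bool" where
  "flat_chain E B C \<longleftrightarrow> C \<subseteq> proper_flats E B \<and> (\<forall>F\<in>C. \<forall>G\<in>C. F \<subseteq> G \<or> G \<subseteq> F)"

definition maximal_flat_chain :: "nat set \<Rightarrow> nat set set \<Rightarrow> nat set set \<Rightarrow> bool" where
  "maximal_flat_chain E B C \<longleftrightarrow> flat_chain E B C \<and>
     (\<forall>C'. flat_chain E B C' \<and> C \<subseteq> C' \<longrightarrow> C' = C)"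

definition chow_degree :: "nat set \<Rightarrow> nat set set \<Rightarrow> cpoly \<Rightarrow> real" where
  "chow_degree E B p = (THE c. \<forall>C. maximal_flat_chain E B C \<longrightarrow>
       p - Poly_Mapping.single (0::nat set \<Rightarrow>\<^sub>0 nat) c * (\<Prod>F\<in>C. xvar F) \<in> chow_ideal E B)"

definition chow_alpha :: "nat set \<Rightarrow> nat set set \<Rightarrow> nat \<Rightarrow> cpoly" where
  "chow_alpha E B i = (\<Sum>F\<in>{F\<in>proper_flats E B. i \<in> F}. xvar F)"

definition h_class :: "nat set \<Rightarrow> nat set set \<Rightarrow> nat set \<Rightarrow> cpoly" where
  "h_class E B S = chow_alpha E B 0 - (\<Sum>G\<in>{G. is_flat E B G \<and> G \<noteq> E \<and> S \<subseteq> G}. xvar G)"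

end

(* The wedge of M and H_{A_1}, ..., H_{A_d} is U_{1,E} iff for every e some basis b containing e has
   b - {e} as a transversal of the A_j. By Rado's theorem for the contraction M/e this is
   DHR: the rank of a union in M/e is one less than its rank, with e added, in M.

   For the degree, products of the classes h_S obey (h_F - h_{F \<union> F'}) (h_F' - h_{F \<union> F'}) = 0 and
   h_{i} = 0. These relations straighten every degree-d product into a real multiple of
   h_E^d = alpha^d, which in turn equals the monomial of every maximal chain. The multiple is
   detected by the linear functional sending a monomial h_{S_1} ... h_{S_d} to 1 if it satisfies
   DHR and to 0 otherwise: by submodularity it vanishes on the ideal generated by the same
   relations, hence, after expressing x_F in the h's by Moebius inversion, on the Chow ideal. *)
theory Submission
  imports Defs "HOL-Library.Multiset"
begin

text \<open>\<open>chow_degree\<close> is a definite description, so it has a value only if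
  \<open>alpha ^ d\<close> lies outside the Chow ideal: otherwise every real number would fit.
  Straightening cannot show this. The functional \<open>hdeg\<close> shows it and reads off the
  coefficient at the same time, in place of a structure theory of the top-degree piece.

  Why DHR respects the quadratic relation: multiply the relation by a family N of further factors.
  All four terms get value 0 unless N satisfies DHR and every subfamily of N still does after two
  factors with union F \<union> F' join it. In that case let a and b say that subfamilies joined by
  F alone, or by F' alone, meet their bound. The relation becomes [a and b] + 1 = [a] + [b], which
  means that a or b holds, and submodularity rules out that both fail.

  The functional lives on a polynomial ring with free variables indexed by sets. There it can be
  prescribed on monomials, and passing to the Chow ring means showing that all multiples of the
  image of each generator are sent to 0.\<close>

section \<open>Rank and closure in a loopless matroid\<close>

locale loopless_matroid =
  fixes E :: "nat set" and B :: "nat set set" and d :: nat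
  assumes bases: "matroid_bases E B"
    and loopless: "loopless E B"
    and card_base: "b \<in> B \<Longrightarrow> card b = d + 1"
begin

lemma finite_E: "finite E" and B_nonempty: "B \<noteq> {}"
  and base_subset: "b \<in> B \<Longrightarrow> b \<subseteq> E"
  and base_exchange: "\<lbrakk>b1 \<in> B; b2 \<in> B; x \<in> b1 - b2\<rbrakk> \<Longrightarrow> \<exists>y\<in>b2 - b1. insert y (b1 - {x}) \<in> B"
  using bases by (auto simp: matroid_bases_def)

lemma finite_base: "b \<in> B \<Longrightarrow> finite b"
  using base_subset finite_E finite_subset by blast

lemma finite_B: "finite B"
  using base_subset finite_E by (meson PowI finite_Pow_iff finite_subset subsetI)

lemma card_le_mrank: "b \<in> B \<Longrightarrow> card (b \<inter> S) \<le> mrank B S"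
  unfolding mrank_def by (intro Max_ge) (auto simp: finite_B)

lemma mrank_attained: obtains b where "b \<in> B" "card (b \<inter> S) = mrank B S"
proof -
  have "mrank B S \<in> (\<lambda>b. card (b \<inter> S)) ` B"
    unfolding mrank_def by (intro Max_in) (auto simp: finite_B B_nonempty)
  then show ?thesis using that by auto
qed

lemma mrank_leI: "(\<And>b. b \<in> B \<Longrightarrow> card (b \<inter> S) \<le> k) \<Longrightarrow> mrank B S \<le> k"
  by (metis mrank_attained)

lemma mrank_mono: "S \<subseteq> T \<Longrightarrow> mrank B S \<le> mrank B T"
  by (rule mrank_leI) (meson Int_mono card_le_mrank card_mono finite_Int finite_base le_trans subset_refl)

lemma mrank_le_card: "finite S \<Longrightarrow> mrank B S \<le> card S"
  by (rule mrank_leI) (simp add: card_mono)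

lemma mrank_empty [simp]: "mrank B {} = 0"
  using mrank_le_card[of "{}"] by simp

lemma mrank_le: "mrank B S \<le> d + 1"
  by (rule mrank_leI) (metis Int_lower1 card_base card_mono finite_base)

lemma mrank_E: "mrank B E = d + 1"
  by (metis B_nonempty Int_absorb2 base_subset card_base card_le_mrank ex_in_conv le_antisym mrank_le)

lemma mrank_singleton: "e \<in> E \<Longrightarrow> mrank B {e} = 1"
  using loopless by (simp add: loopless_def)

lemma mrank_pos: "\<lbrakk>S \<subseteq> E; S \<noteq> {}\<rbrakk> \<Longrightarrow> 1 \<le> mrank B S"
  by (metis bot.extremum ex_in_conv insert_subset mrank_mono mrank_singleton subset_iff)

text \<open>Among the bases containing \<open>J\<close>, one with fewest elements outside
  \<open>J \<union> b1\<close> lies inside \<open>J \<union> b1\<close>. Without an augmentation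
  this base \<open>c\<close> satisfies \<open>c - b1 = J - I\<close> and
  \<open>b1 - c \<subseteq> I - J\<close>. Bases are equicardinal, so
  \<open>card (J - I) \<le> card (I - J)\<close>, against \<open>card I < card J\<close>.\<close>

lemma augment:
  assumes "b1 \<in> B" "b2 \<in> B" "I \<subseteq> b1" "J \<subseteq> b2" "card I < card J"
  obtains x b where "x \<in> J - I" "b \<in> B" "insert x I \<subseteq> b"
proof (rule ccontr)
  assume "\<not> thesis"
  then have no: "\<And>x b. \<lbrakk>x \<in> J - I; b \<in> B\<rbrakk> \<Longrightarrow> \<not> insert x I \<subseteq> b" using that by blast
  define Q where "Q = {b \<in> B. J \<subseteq> b}"
  define f where "f b = card (b - (J \<union> b1))" for b
  have "finite Q" "b2 \<in> Q" using finite_B assms by (auto simp: Q_def)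
  then obtain c where c: "c \<in> Q" and c_min: "\<And>b. b \<in> Q \<Longrightarrow> f c \<le> f b"
    using ex_has_least_nat[of "\<lambda>b. b \<in> Q" b2 f] by metis
  have cB: "c \<in> B" "J \<subseteq> c" and fc: "finite c" using c finite_base by (auto simp: Q_def)
  \<comment> \<open>A point of \<open>J - I\<close> in \<open>b1\<close> would make
    \<open>b1\<close> itself the forbidden base.\<close>
  have Jb1: "J - b1 = J - I" using no assms(1,3) by blast
  have sub: "c \<subseteq> J \<union> b1"
  proof (rule ccontr)
    assume "\<not> c \<subseteq> J \<union> b1"
    then obtain x where x: "x \<in> c" "x \<notin> J" "x \<notin> b1" by blast
    then obtain y where y: "y \<in> b1 - c" "insert y (c - {x}) \<in> B"
      using base_exchange[OF cB(1) assms(1), of x] by blast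
    then have "insert y (c - {x}) \<in> Q" using cB x by (auto simp: Q_def)
    then have "f c \<le> f (insert y (c - {x}))" by (rule c_min)
    moreover have "insert y (c - {x}) - (J \<union> b1) \<subset> c - (J \<union> b1)" using x y(1) by auto
    ultimately show False using fc by (metis f_def finite_Diff leD psubset_card_mono)
  qed
  have cb1: "c - b1 = J - I" using sub cB Jb1 by blast
  have b1c: "b1 - c \<subseteq> I - J"
  proof
    fix x assume x: "x \<in> b1 - c"
    have "x \<in> I"
    proof (rule ccontr)
      assume "x \<notin> I"
      obtain y where "y \<in> c - b1" "insert y (b1 - {x}) \<in> B"
        using base_exchange[OF assms(1) cB(1) x] by blast
      with no[of y "insert y (b1 - {x})"] cb1 \<open>x \<notin> I\<close> assms(3) show False by blast
    qed
    then show "x \<in> I - J" using x cB by blast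
  qed
  have fin: "finite b1" "finite I" "finite J"
    using assms finite_base by (auto intro: finite_subset)
  have "card J - card (I \<inter> J) = card (J - I)" "card I - card (I \<inter> J) = card (I - J)"
    using fin by (simp_all add: card_Diff_subset_Int Int_commute)
  moreover have "card (c - b1) = card (b1 - c)"
    using fin fc card_base[OF cB(1)] card_base[OF assms(1)]
    by (simp add: card_Diff_subset_Int Int_commute)
  moreover have "card (b1 - c) \<le> card (I - J)"
    using fin b1c by (intro card_mono) auto
  moreover have "card (I \<inter> J) \<le> card I" using fin by (intro card_mono) auto
  ultimately show False using assms(5) cb1 by simp
qed

text \<open>Among the bases containing \<open>I\<close>, take one that meets \<open>T\<close> in the
  most points. If it fell short of the rank, \<open>augment\<close> against a base attaining the
  rank of \<open>T\<close> would enlarge the intersection.\<close>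

lemma extend_independent:
  assumes "b \<in> B" "I \<subseteq> b" "I \<subseteq> T"
  obtains c where "c \<in> B" "I \<subseteq> c" "card (c \<inter> T) = mrank B T"
proof -
  define Q where "Q = {c \<in> B. I \<subseteq> c}"
  have "finite Q" "b \<in> Q" using finite_B assms by (auto simp: Q_def)
  moreover define k where "k = Max ((\<lambda>c. card (c \<inter> T)) ` Q)"
  ultimately have "k \<in> (\<lambda>c. card (c \<inter> T)) ` Q" "\<forall>c\<in>Q. card (c \<inter> T) \<le> k"
    unfolding k_def by (auto intro!: Max_in Max_ge)
  then obtain c where c: "c \<in> Q" and c_max: "\<And>c'. c' \<in> Q \<Longrightarrow> card (c' \<inter> T) \<le> card (c \<inter> T)"
    by auto
  have cB: "c \<in> B" "I \<subseteq> c" using c by (auto simp: Q_def)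
  have "card (c \<inter> T) = mrank B T"
  proof (rule ccontr)
    assume "card (c \<inter> T) \<noteq> mrank B T"
    then have lt: "card (c \<inter> T) < mrank B T" using card_le_mrank[OF cB(1), of T] by simp
    obtain b2 where b2: "b2 \<in> B" "card (b2 \<inter> T) = mrank B T" by (rule mrank_attained)
    obtain x b' where x: "x \<in> b2 \<inter> T - c \<inter> T" and b': "b' \<in> B" "insert x (c \<inter> T) \<subseteq> b'"
      using augment[OF cB(1) b2(1), of "c \<inter> T" "b2 \<inter> T"] lt b2(2) by auto
    have "b' \<in> Q" using b' cB assms(3) by (auto simp: Q_def)
    then have "card (b' \<inter> T) \<le> card (c \<inter> T)" by (rule c_max)
    moreover have "c \<inter> T \<subset> b' \<inter> T" using b' x by blast
    ultimately show False
      by (metis b'(1) finite_Int finite_base leD psubset_card_mono)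
  qed
  with cB show ?thesis by (rule that)
qed

text \<open>A largest independent subset of \<open>X \<inter> Y\<close> extends to a base
  \<open>c\<close> attaining the rank of \<open>X \<union> Y\<close>. For this one base, counting
  points is modular, and its intersections with \<open>X\<close> and \<open>Y\<close> are bounded by
  the ranks.\<close>

lemma mrank_submodular: "mrank B (X \<union> Y) + mrank B (X \<inter> Y) \<le> mrank B X + mrank B Y"
proof -
  obtain b where b: "b \<in> B" "card (b \<inter> (X \<inter> Y)) = mrank B (X \<inter> Y)" by (rule mrank_attained)
  obtain c where c: "c \<in> B" "b \<inter> (X \<inter> Y) \<subseteq> c" "card (c \<inter> (X \<union> Y)) = mrank B (X \<union> Y)"
    using extend_independent[OF b(1), of "b \<inter> (X \<inter> Y)" "X \<union> Y"] by blast
  have fc: "finite c" using c(1) by (rule finite_base)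
  have "card (b \<inter> (X \<inter> Y)) \<le> card (c \<inter> (X \<inter> Y))"
    using c(2) fc by (intro card_mono) auto
  moreover have "card (c \<inter> X) + card (c \<inter> Y) = card (c \<inter> (X \<union> Y)) + card (c \<inter> (X \<inter> Y))"
  proof -
    have "(c \<inter> X) \<union> (c \<inter> Y) = c \<inter> (X \<union> Y)" "(c \<inter> X) \<inter> (c \<inter> Y) = c \<inter> (X \<inter> Y)" by auto
    then show ?thesis using card_Un_Int[of "c \<inter> X" "c \<inter> Y"] fc by simp
  qed
  ultimately show ?thesis
    using b(2) c(3) card_le_mrank[OF c(1), of X] card_le_mrank[OF c(1), of Y] by linarith
qed

lemma mrank_insert_le: "mrank B (insert e S) \<le> Suc (mrank B S)"
  using mrank_submodular[of S "{e}"] mrank_le_card[of "{e}"] by simp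

text \<open>Diminishing returns: by submodularity the rank gained from \<open>e\<close> can only
  shrink as the set grows.\<close>

lemma mrank_insert_Un:
  assumes "mrank B (insert e S) = mrank B S"
  shows "mrank B (insert e (S \<union> X)) = mrank B (S \<union> X)"
proof -
  have "mrank B S \<le> mrank B ((S \<union> X) \<inter> insert e S)" by (rule mrank_mono) auto
  moreover have "(S \<union> X) \<union> insert e S = insert e (S \<union> X)" by auto
  ultimately have "mrank B (insert e (S \<union> X)) \<le> mrank B (S \<union> X)"
    using mrank_submodular[of "S \<union> X" "insert e S"] assms by simp
  then show ?thesis by (simp add: antisym mrank_mono subset_insertI)
qed

section \<open>Closure and flats\<close>

definition cl :: "nat set \<Rightarrow> nat set" where
  "cl S = {e \<in> E. mrank B (insert e S) = mrank B S}"

lemma cl_subset: "cl S \<subseteq> E"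
  by (auto simp: cl_def)

lemma subset_cl: "S \<subseteq> E \<Longrightarrow> S \<subseteq> cl S"
  by (auto simp: cl_def insert_absorb)

text \<open>The extra \<open>X\<close> lets closures be exchanged inside unions. \<open>S\<close>
  stays in the union because it may reach outside \<open>E\<close>, while \<open>cl S\<close> does
  not.\<close>

lemma mrank_Un_cl: "mrank B (cl S \<union> S \<union> X) = mrank B (S \<union> X)"
proof -
  have "finite T \<Longrightarrow> T \<subseteq> cl S \<Longrightarrow> mrank B (T \<union> (S \<union> X)) = mrank B (S \<union> X)" for T
  proof (induction rule: finite_induct)
    case (insert e T)
    then show ?case
      using mrank_insert_Un[of e S "T \<union> X"] by (simp add: cl_def ac_simps)
  qed simp
  moreover have "finite (cl S)" using cl_subset finite_E by (rule finite_subset)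
  ultimately show ?thesis by (metis Un_assoc subset_refl)
qed

lemma mrank_cl_Un: "S \<subseteq> E \<Longrightarrow> mrank B (cl S \<union> X) = mrank B (S \<union> X)"
  using mrank_Un_cl[of S X] subset_cl[of S] by (simp add: Un_absorb2)

lemma mrank_cl: "S \<subseteq> E \<Longrightarrow> mrank B (cl S) = mrank B S"
  using mrank_cl_Un[of S "{}"] by simp

lemma flat_cl: "S \<subseteq> E \<Longrightarrow> is_flat E B (cl S)"
proof -
  assume S: "S \<subseteq> E"
  have "mrank B (cl S) < mrank B (insert e (cl S))" if "e \<in> E - cl S" for e
  proof -
    have "mrank B S \<noteq> mrank B (insert e S)" using that by (auto simp: cl_def)
    then have "mrank B S < mrank B (insert e S)"
      by (simp add: mrank_mono order_less_le subset_insertI)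
    also have "\<dots> \<le> mrank B (insert e (cl S))"
      using subset_cl[OF S] by (intro mrank_mono) auto
    finally show ?thesis using mrank_cl[OF S] by simp
  qed
  then show ?thesis using cl_subset by (auto simp: is_flat_def)
qed

lemma cl_subset_flat:
  assumes "is_flat E B F" "S \<subseteq> F"
  shows "cl S \<subseteq> F"
proof
  fix e assume e: "e \<in> cl S"
  then have "mrank B (insert e (S \<union> F)) = mrank B (S \<union> F)"
    by (intro mrank_insert_Un) (simp add: cl_def)
  moreover have "S \<union> F = F" using assms by auto
  ultimately have "mrank B (insert e F) = mrank B F" by simp
  then show "e \<in> F"
    using assms(1) e cl_subset[of S] unfolding is_flat_def by force
qed

lemma cl_subset_flat_iff: "\<lbrakk>is_flat E B F; S \<subseteq> E\<rbrakk> \<Longrightarrow> cl S \<subseteq> F \<longleftrightarrow> S \<subseteq> F"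
  using cl_subset_flat subset_cl by blast

lemma flat_subset: "is_flat E B F \<Longrightarrow> F \<subseteq> E"
  by (simp add: is_flat_def)

lemma finite_flats: "finite {F. is_flat E B F}"
  by (rule finite_subset[of _ "Pow E"]) (auto simp: finite_E dest: flat_subset)

lemma flat_E: "is_flat E B E"
  by (simp add: is_flat_def)

lemma flat_mrank_less: "\<lbrakk>is_flat E B F; F \<subset> G; G \<subseteq> E\<rbrakk> \<Longrightarrow> mrank B F < mrank B G"
proof -
  assume "is_flat E B F" "F \<subset> G" "G \<subseteq> E"
  then obtain e where "e \<in> G" "e \<in> E - F" by blast
  then have "mrank B F < mrank B (insert e F)" using \<open>is_flat E B F\<close> by (simp add: is_flat_def)
  also have "\<dots> \<le> mrank B G" using \<open>e \<in> G\<close> \<open>F \<subset> G\<close> by (intro mrank_mono) auto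
  finally show ?thesis .
qed

lemma proper_flat_mrank_le: "F \<in> proper_flats E B \<Longrightarrow> mrank B F \<le> d"
  using flat_mrank_less[of F E] flat_subset[of F] mrank_E by (auto simp: proper_flats_def psubset_eq)

lemma exists_rank_increment:
  assumes "S \<subseteq> T" "finite T" "mrank B S < mrank B T"
  shows "\<exists>e\<in>T. mrank B (insert e S) = Suc (mrank B S)"
proof (rule ccontr)
  assume no: "\<not> ?thesis"
  have same: "mrank B (insert e S) = mrank B S" if e: "e \<in> T" for e
  proof -
    have "mrank B (insert e S) \<noteq> Suc (mrank B S)" using no e by blast
    then show ?thesis
      using mrank_insert_le[of e S] mrank_mono[of S "insert e S"] by (simp add: subset_insertI)
  qed
  have "finite X \<Longrightarrow> X \<subseteq> T \<Longrightarrow> mrank B (S \<union> X) = mrank B S" for X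
  proof (induction rule: finite_induct)
    case (insert e X)
    then show ?case using mrank_insert_Un[OF same, of e X] by simp
  qed simp
  from this[of T] assms show False by (simp add: Un_absorb1)
qed

end

section \<open>Rado transversals and the iterated wedge\<close>

text \<open>Rado's theorem with an offset. Taking for \<open>f X\<close> the rank of
  \<open>insert e X\<close>, with \<open>c = 1\<close>, covers the contraction by \<open>e\<close>
  without forming it. A set \<open>A i\<close> with two points can always lose one of them: if both
  deletions broke the condition, on \<open>J\<close> and on \<open>K\<close>, submodularity on the
  two deficient unions would contradict it. Deletions end at singletons.\<close>

lemma rado_submodular:
  fixes f :: "'a set \<Rightarrow> nat" and A :: "'i \<Rightarrow> 'a set"
  assumes submod: "\<And>X Y. f (X \<union> Y) + f (X \<inter> Y) \<le> f X + f Y"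
    and mono: "\<And>X Y. X \<subseteq> Y \<Longrightarrow> f X \<le> f Y"
    and "finite I" "\<And>i. i \<in> I \<Longrightarrow> finite (A i) \<and> A i \<noteq> {}"
    and "\<And>J. J \<subseteq> I \<Longrightarrow> card J + c \<le> f (\<Union>j\<in>J. A j)"
  shows "\<exists>a. (\<forall>i\<in>I. a i \<in> A i) \<and> card I + c \<le> f (a ` I)"
  using assms(4,5)
proof (induction "\<Sum>i\<in>I. card (A i)" arbitrary: A rule: less_induct)
  case less
  show ?case
  proof (cases "\<forall>i\<in>I. \<exists>x. A i = {x}")
    case True
    then obtain a where a: "\<forall>i\<in>I. A i = {a i}" by metis
    have "(\<Union>j\<in>I. A j) = a ` I" using a by auto
    with less.prems(2)[of I] a show ?thesis by auto
  next
    case False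
    then obtain i where i: "i \<in> I" and "\<nexists>x. A i = {x}" by blast
    then obtain x y where xy: "x \<in> A i" "y \<in> A i" "x \<noteq> y"
      using less.prems(1) by (metis ex_in_conv is_singletonI' is_singleton_def)
    define D where "D z = A(i := A i - {z})" for z
    have smaller: "(\<Sum>k\<in>I. card (D z k)) < (\<Sum>k\<in>I. card (A k))" if "z \<in> A i" for z
    proof (rule sum_strict_mono_ex1)
      show "\<forall>k\<in>I. card (D z k) \<le> card (A k)"
        using less.prems(1) by (auto simp: D_def intro: card_mono)
      show "\<exists>k\<in>I. card (D z k) < card (A k)"
        using i that less.prems(1)[OF i] card_Diff1_less[of "A i" z] by (auto simp: D_def intro!: bexI[of _ i])
    qed (fact assms(3))
    have sub: "D z k \<subseteq> A k" for z k by (auto simp: D_def)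
    have ne: "finite (D z k) \<and> D z k \<noteq> {}" if "k \<in> I" "z \<in> {x, y}" for z k
      using less.prems(1)[OF that(1)] that xy by (auto simp: D_def)
    have "\<exists>z\<in>{x, y}. \<forall>J\<subseteq>I. card J + c \<le> f (\<Union>j\<in>J. D z j)"
    proof (rule ccontr)
      assume "\<not> ?thesis"
      then obtain J K where J: "J \<subseteq> I" "f (\<Union>j\<in>J. D x j) < card J + c"
        and K: "K \<subseteq> I" "f (\<Union>j\<in>K. D y j) < card K + c"
        by (auto simp: not_le)
      \<comment> \<open>Only families using index \<open>i\<close> see the deletion, so a deficient
        family contains \<open>i\<close>.\<close>
      have inJ: "i \<in> L" if "L \<subseteq> I" "f (\<Union>j\<in>L. D z j) < card L + c" for L z
      proof (rule ccontr)
        assume "i \<notin> L"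
        then have "(\<Union>j\<in>L. D z j) = (\<Union>j\<in>L. A j)" by (auto simp: D_def)
        with less.prems(2)[OF that(1)] that(2) show False by simp
      qed
      have iJ: "i \<in> J" "i \<in> K" using inJ J K by blast+
      have fin: "finite J" "finite K" using J K assms(3) finite_subset by auto
      let ?X = "\<Union>j\<in>J. D x j" and ?Y = "\<Union>j\<in>K. D y j"
      \<comment> \<open>As \<open>x \<noteq> y\<close>, the two reduced copies of \<open>A i\<close>
        together lose no point; the intersection gives up only the index \<open>i\<close>. This loss
        of 1 is less than the two strict deficiencies combined.\<close>
      have "(\<Union>j\<in>J \<union> K. A j) \<subseteq> ?X \<union> ?Y"
      proof
        fix w assume "w \<in> (\<Union>j\<in>J \<union> K. A j)"
        then obtain j where j: "j \<in> J \<union> K" "w \<in> A j" by blast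
        show "w \<in> ?X \<union> ?Y"
        proof (cases "j = i")
          case True
          then have "w \<in> D x i \<or> w \<in> D y i" using j xy(3) by (auto simp: D_def)
          then show ?thesis using iJ by blast
        next
          case False
          then have "w \<in> D x j \<and> w \<in> D y j" using j by (auto simp: D_def)
          then show ?thesis using j by blast
        qed
      qed
      then have "card (J \<union> K) + c \<le> f (?X \<union> ?Y)"
        using less.prems(2)[of "J \<union> K"] J K mono by (meson Un_least le_trans)
      moreover have "(\<Union>j\<in>J \<inter> K - {i}. A j) \<subseteq> ?X \<inter> ?Y" by (fastforce simp: D_def)
      then have "card (J \<inter> K - {i}) + c \<le> f (?X \<inter> ?Y)"
        using less.prems(2)[of "J \<inter> K - {i}"] J mono by (meson Diff_subset Int_lower1 le_trans subset_trans)
      moreover have "card (J \<union> K) + card (J \<inter> K) = card J + card K"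
        using card_Un_Int[OF fin] by simp
      moreover have "Suc (card (J \<inter> K - {i})) = card (J \<inter> K)"
        using iJ fin by (intro card_Suc_Diff1) auto
      ultimately show False using submod[of ?X ?Y] J(2) K(2) by linarith
    qed
    then obtain z where z: "z \<in> {x, y}" and hall: "\<And>J. J \<subseteq> I \<Longrightarrow> card J + c \<le> f (\<Union>j\<in>J. D z j)"
      by blast
    have "\<exists>a. (\<forall>i\<in>I. a i \<in> D z i) \<and> card I + c \<le> f (a ` I)"
      by (rule less.hyps) (use smaller z xy ne hall in auto)
    with sub show ?thesis by blast
  qed
qed

section \<open>Spanning sets of the iterated wedge\<close>

lemma spanning_sets_H_bases:
  "S \<subseteq> E \<Longrightarrow> spanning_sets E (H_bases E S) = {T. T \<subseteq> E \<and> (\<exists>i\<in>S. E - {i} \<subseteq> T)}"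
  by (auto simp: spanning_sets_def H_bases_def)

lemma spanning_sets_U1_bases: "spanning_sets E (U1_bases E) = {T. T \<subseteq> E \<and> T \<noteq> {}}"
  by (auto simp: spanning_sets_def U1_bases_def)

text \<open>A spanning set of \<open>H_bases E S\<close> misses at most one point, and that point
  lies in \<open>S\<close>. Each wedge thus allows the deletion of one chosen point of
  \<open>A j\<close>; the interval for \<open>T\<close> records that a chosen point may be deleted
  or kept.\<close>

lemma iter_wedge_sp_eq:
  assumes "\<forall>j\<in>{1..k}. A j \<subseteq> E"
  shows "iter_wedge_sp E B A k =
    {T. \<exists>S\<in>spanning_sets E B. \<exists>a. (\<forall>j\<in>{1..k}. a j \<in> A j) \<and> S - a ` {1..k} \<subseteq> T \<and> T \<subseteq> S}"
  using assms
proof (induction k)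
  case 0
  show ?case by auto
next
  case (Suc k)
  have ivl: "{1..Suc k} = insert (Suc k) {1..k}" by auto
  have IH: "iter_wedge_sp E B A k =
    {T. \<exists>S\<in>spanning_sets E B. \<exists>a. (\<forall>j\<in>{1..k}. a j \<in> A j) \<and> S - a ` {1..k} \<subseteq> T \<and> T \<subseteq> S}"
    using Suc by simp
  have A: "A (Suc k) \<subseteq> E" using Suc.prems by simp
  show ?case (is "?L = ?R")
  proof (intro equalityI subsetI)
    fix T assume "T \<in> ?L"
    then obtain T1 T2 where T: "T = T1 \<inter> T2" "T1 \<in> iter_wedge_sp E B A k"
      "T2 \<in> spanning_sets E (H_bases E (A (Suc k)))"
      by (auto simp: wedge_sp_def)
    obtain S a where S: "S \<in> spanning_sets E B" "\<forall>j\<in>{1..k}. a j \<in> A j" "S - a ` {1..k} \<subseteq> T1" "T1 \<subseteq> S"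
      using T(2) IH by auto
    obtain i where i: "i \<in> A (Suc k)" "E - {i} \<subseteq> T2"
      using T(3) A by (auto simp: spanning_sets_H_bases)
    define a' where "a' = a(Suc k := i)"
    have "a' ` {1..Suc k} = insert i (a ` {1..k})" by (auto simp: ivl a'_def)
    moreover have "S \<subseteq> E" using S(1) by (simp add: spanning_sets_def)
    ultimately have "S - a' ` {1..Suc k} \<subseteq> T" using S(3) i(2) T(1) by auto
    moreover have "\<forall>j\<in>{1..Suc k}. a' j \<in> A j" using S(2) i(1) by (auto simp: ivl a'_def)
    moreover have "T \<subseteq> S" using S(4) T(1) by auto
    ultimately show "T \<in> ?R" using S(1) by blast
  next
    fix T assume "T \<in> ?R"
    then obtain S a where S: "S \<in> spanning_sets E B" "\<forall>j\<in>{1..Suc k}. a j \<in> A j"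
      "S - a ` {1..Suc k} \<subseteq> T" "T \<subseteq> S"
      by auto
    define i where "i = a (Suc k)"
    have SE: "S \<subseteq> E" using S(1) by (simp add: spanning_sets_def)
    have i: "i \<in> A (Suc k)" using S(2) by (simp add: i_def)
    \<comment> \<open>The last chosen point \<open>i\<close> is put back in the first factor; the
      second factor deletes it again unless it belongs to \<open>T\<close>.\<close>
    have "S - a ` {1..k} \<subseteq> S \<inter> insert i T"
      using S(3) unfolding ivl i_def by auto
    moreover have "\<forall>j\<in>{1..k}. a j \<in> A j" using S(2) by simp
    ultimately have "S \<inter> insert i T \<in> iter_wedge_sp E B A k"
      unfolding IH using S(1) by blast
    moreover have "T \<union> (E - {i}) \<in> spanning_sets E (H_bases E (A (Suc k)))"
      using i SE S(4) A by (auto simp: spanning_sets_H_bases)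
    moreover have "T = (S \<inter> insert i T) \<inter> (T \<union> (E - {i}))" using S(4) by auto
    ultimately show "T \<in> ?L" by (auto simp: wedge_sp_def)
  qed
qed

context loopless_matroid
begin

text \<open>Towards transversals this is \<open>rado_submodular\<close> with offset 1. Conversely,
  choose \<open>e\<close> in one of the sets indexed by \<open>J\<close>: discarding the points
  indexed outside \<open>J\<close> costs rank at most \<open>d - card J\<close>, and what is left
  lies in the union over \<open>J\<close>.\<close>

lemma DHR_iff_transversals:
  assumes "\<forall>j\<in>{1..d}. A j \<noteq> {} \<and> A j \<subseteq> E"
  shows "DHR B A d \<longleftrightarrow>
    (\<forall>e\<in>E. \<exists>a. (\<forall>j\<in>{1..d}. a j \<in> A j) \<and> d + 1 \<le> mrank B (insert e (a ` {1..d})))"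
proof (intro iffI ballI)
  fix e assume dhr: "DHR B A d" and e: "e \<in> E"
  let ?f = "\<lambda>X. mrank B (insert e X)"
  have "\<exists>a. (\<forall>j\<in>{1..d}. a j \<in> A j) \<and> card {1..d} + 1 \<le> ?f (a ` {1..d})"
  proof (rule rado_submodular)
    fix X Y
    show "?f (X \<union> Y) + ?f (X \<inter> Y) \<le> ?f X + ?f Y"
      using mrank_submodular[of "insert e X" "insert e Y"] by simp
    show "X \<subseteq> Y \<Longrightarrow> ?f X \<le> ?f Y" by (rule mrank_mono) auto
  next
    fix i assume "i \<in> {1..d}"
    then show "finite (A i) \<and> A i \<noteq> {}" using assms finite_E finite_subset by metis
  next
    fix J assume J: "J \<subseteq> {1..d}"
    show "card J + 1 \<le> ?f (\<Union>j\<in>J. A j)"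
    proof (cases "J = {}")
      case True
      \<comment> \<open>For the empty subfamily the offset 1 is the rank of \<open>{e}\<close>: this
        is where looplessness enters.\<close>
      then show ?thesis using mrank_singleton[OF e] by simp
    next
      case False
      then have "card J + 1 \<le> mrank B (\<Union>j\<in>J. A j)" using dhr J by (simp add: DHR_def)
      also have "\<dots> \<le> ?f (\<Union>j\<in>J. A j)" by (rule mrank_mono) auto
      finally show ?thesis .
    qed
  qed simp
  then show "\<exists>a. (\<forall>j\<in>{1..d}. a j \<in> A j) \<and> d + 1 \<le> mrank B (insert e (a ` {1..d}))" by simp
next
  assume tr: "\<forall>e\<in>E. \<exists>a. (\<forall>j\<in>{1..d}. a j \<in> A j) \<and> d + 1 \<le> mrank B (insert e (a ` {1..d}))"
  show "DHR B A d"
    unfolding DHR_def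
  proof (intro allI impI)
    fix J assume J: "J \<subseteq> {1..d} \<and> J \<noteq> {}"
    then obtain j0 e where e: "j0 \<in> J" "e \<in> A j0" using assms by blast
    then have "e \<in> E" using J assms by blast
    then obtain a where a: "\<forall>j\<in>{1..d}. a j \<in> A j" "d + 1 \<le> mrank B (insert e (a ` {1..d}))"
      using tr by blast
    let ?K = "{1..d} - J"
    have "insert e (a ` {1..d}) = insert e (a ` J) \<union> a ` ?K" using J by auto
    then have "d + 1 \<le> mrank B (insert e (a ` J)) + mrank B (a ` ?K)"
      using a(2) mrank_submodular[of "insert e (a ` J)" "a ` ?K"] by simp
    also have "mrank B (a ` ?K) \<le> card ?K"
      by (meson card_image_le finite_Diff finite_atLeastAtMost finite_imageI le_trans mrank_le_card)
    also have "card ?K = d - card J" using J by (simp add: card_Diff_subset finite_subset[of J "{1..d}"])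
    also have "mrank B (insert e (a ` J)) \<le> mrank B (\<Union>j\<in>J. A j)"
      by (rule mrank_mono) (use e a(1) J in auto)
    finally show "card J + 1 \<le> mrank B (\<Union>j\<in>J. A j)"
      using J card_mono[of "{1..d}" J] by simp
  qed
qed

lemma full_rank_iff: "d + 1 \<le> mrank B S \<longleftrightarrow> (\<exists>b\<in>B. b \<subseteq> S)"
proof
  assume "d + 1 \<le> mrank B S"
  moreover obtain b where b: "b \<in> B" "card (b \<inter> S) = mrank B S" by (rule mrank_attained)
  ultimately have "b \<inter> S = b"
    using card_base[OF b(1)] finite_base[OF b(1)] mrank_le[of S] by (intro card_subset_eq) auto
  with b show "\<exists>b\<in>B. b \<subseteq> S" by blast
next
  assume "\<exists>b\<in>B. b \<subseteq> S"
  then show "d + 1 \<le> mrank B S" by (metis Int_absorb2 card_base card_le_mrank)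
qed

theorem wedge_eq_U1_iff_DHR:
  assumes A: "\<forall>j\<in>{1..d}. A j \<noteq> {} \<and> A j \<subseteq> E"
  shows "iter_wedge_sp E B A d = spanning_sets E (U1_bases E) \<longleftrightarrow> DHR B A d"
proof -
  have iter: "T \<in> iter_wedge_sp E B A d \<longleftrightarrow>
      (\<exists>S\<in>spanning_sets E B. \<exists>a. (\<forall>j\<in>{1..d}. a j \<in> A j) \<and> S - a ` {1..d} \<subseteq> T \<and> T \<subseteq> S)" for T
    using iter_wedge_sp_eq[of d A E B] A by auto
  have card_image: "card (a ` {1..d}) \<le> d" for a :: "nat \<Rightarrow> nat"
    using card_image_le[of "{1..d}" a] by simp
  show ?thesis
    unfolding DHR_iff_transversals[OF A] full_rank_iff
  proof (intro iffI ballI)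
    fix e assume eq: "iter_wedge_sp E B A d = spanning_sets E (U1_bases E)" and "e \<in> E"
    then have "{e} \<in> iter_wedge_sp E B A d" by (simp add: spanning_sets_U1_bases)
    then obtain S a where S: "S \<in> spanning_sets E B" "\<forall>j\<in>{1..d}. a j \<in> A j" "S - a ` {1..d} \<subseteq> {e}"
      unfolding iter by blast
    then obtain b where "b \<in> B" "b \<subseteq> S" by (auto simp: spanning_sets_def)
    with S show "\<exists>a. (\<forall>j\<in>{1..d}. a j \<in> A j) \<and> (\<exists>b\<in>B. b \<subseteq> insert e (a ` {1..d}))" by blast
  next
    assume tr: "\<forall>e\<in>E. \<exists>a. (\<forall>j\<in>{1..d}. a j \<in> A j) \<and> (\<exists>b\<in>B. b \<subseteq> insert e (a ` {1..d}))"
    show "iter_wedge_sp E B A d = spanning_sets E (U1_bases E)"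
    proof (intro equalityI subsetI)
      fix T assume "T \<in> iter_wedge_sp E B A d"
      then obtain S a where S: "S \<in> spanning_sets E B" "S - a ` {1..d} \<subseteq> T" "T \<subseteq> S"
        unfolding iter by blast
      then obtain b where b: "b \<in> B" "b \<subseteq> S" by (auto simp: spanning_sets_def)
      \<comment> \<open>At most \<open>d\<close> points are deleted from a base of
        \<open>d + 1\<close> points, so the empty set never occurs, with or without DHR.\<close>
      have "\<not> b \<subseteq> a ` {1..d}"
        using card_base[OF b(1)] card_image[of a] card_mono[of "a ` {1..d}" b] by auto
      then have "T \<noteq> {}" using b S by blast
      then show "T \<in> spanning_sets E (U1_bases E)"
        using S by (auto simp: spanning_sets_U1_bases) (auto simp: spanning_sets_def)
    next
      fix T assume "T \<in> spanning_sets E (U1_bases E)"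
      then obtain e where e: "e \<in> T" and T: "T \<subseteq> E" by (auto simp: spanning_sets_U1_bases)
      then obtain a b where a: "\<forall>j\<in>{1..d}. a j \<in> A j" and b: "b \<in> B" "b \<subseteq> insert e (a ` {1..d})"
        using tr by blast
      have "b \<union> T \<in> spanning_sets E B" using b T base_subset by (auto simp: spanning_sets_def)
      moreover have "b \<union> T - a ` {1..d} \<subseteq> T" using b e by auto
      ultimately show "T \<in> iter_wedge_sp E B A d" unfolding iter using a by blast
    qed
  qed
qed

end

section \<open>Relations between the simplicial generators\<close>

text \<open>A commutative ring is a module over itself, and its submodules are the ideals. The facts
  on spans and subspaces then serve both \<open>chow_ideal\<close> and \<open>hker\<close>.\<close>

interpretation ideal: module "(*) :: 'a \<Rightarrow> 'a \<Rightarrow> 'a::comm_ring_1"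
  by standard (simp_all add: algebra_simps)

\<comment> \<open>as a simp rule it loops with the associativity rule in \<open>mult_ac\<close>\<close>
declare ideal.scale_scale [simp del]

lemma ideal_gen_eq_span: "ideal_gen G = ideal.span G"
  by (simp add: ideal_gen_def ideal.span_explicit)

text \<open>\<open>h_class\<close> takes \<alpha> at the point 0, which therefore has to belong to
  the ground set.\<close>

locale chow_matroid = loopless_matroid +
  assumes zero_in_E: "0 \<in> E"
begin

section \<open>Congruence modulo the Chow ideal\<close>

definition chow_eq :: "cpoly \<Rightarrow> cpoly \<Rightarrow> bool" (infix "\<approx>" 50) where
  "p \<approx> q \<longleftrightarrow> p - q \<in> chow_ideal E B"

abbreviation h :: "nat set \<Rightarrow> cpoly" where
  "h \<equiv> h_class E B"

abbreviation alpha :: cpoly where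
  "alpha \<equiv> chow_alpha E B 0"

lemma subspace_chow_ideal: "ideal.subspace (chow_ideal E B)"
  by (simp add: chow_ideal_def ideal_gen_eq_span ideal.subspace_span)

lemmas chow_ideal_add = ideal.subspace_add[OF subspace_chow_ideal]
  and chow_ideal_diff = ideal.subspace_diff[OF subspace_chow_ideal]
  and chow_ideal_neg = ideal.subspace_neg[OF subspace_chow_ideal]
  and chow_ideal_mult = ideal.subspace_scale[OF subspace_chow_ideal]
  and chow_ideal_sum = ideal.subspace_sum[OF subspace_chow_ideal]

lemma chow_eq_refl [simp]: "p \<approx> p"
  by (simp add: chow_eq_def ideal.subspace_0[OF subspace_chow_ideal])

lemma chow_eq_sym: "p \<approx> q \<Longrightarrow> q \<approx> p"
  using chow_ideal_neg[of "p - q"] by (simp add: chow_eq_def)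

lemma chow_eq_trans [trans]: "\<lbrakk>p \<approx> q; q \<approx> r\<rbrakk> \<Longrightarrow> p \<approx> r"
  using chow_ideal_add[of "p - q" "q - r"] by (simp add: chow_eq_def)

lemma chow_eq_add: "\<lbrakk>p \<approx> q; p' \<approx> q'\<rbrakk> \<Longrightarrow> p + p' \<approx> q + q'"
  using chow_ideal_add[of "p - q" "p' - q'"] by (simp add: chow_eq_def algebra_simps)

lemma chow_eq_diff: "\<lbrakk>p \<approx> q; p' \<approx> q'\<rbrakk> \<Longrightarrow> p - p' \<approx> q - q'"
  using chow_ideal_diff[of "p - q" "p' - q'"] by (simp add: chow_eq_def algebra_simps)

lemma chow_eq_mult_left: "p \<approx> q \<Longrightarrow> r * p \<approx> r * q"
  using chow_ideal_mult[of "p - q" r] by (simp add: chow_eq_def algebra_simps)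

lemma chow_eq_mult_right: "p \<approx> q \<Longrightarrow> p * r \<approx> q * r"
  using chow_eq_mult_left[of p q r] by (simp add: mult.commute)

lemma chow_eq_mult_zero: "p \<approx> 0 \<Longrightarrow> r * p \<approx> 0"
  using chow_eq_mult_left[of p 0 r] by simp

lemma chow_eq_0_iff: "p \<approx> 0 \<longleftrightarrow> p \<in> chow_ideal E B"
  by (simp add: chow_eq_def)

lemma chow_eq_sum_0: "(\<And>i. i \<in> A \<Longrightarrow> f i \<approx> 0) \<Longrightarrow> sum f A \<approx> 0"
  by (simp add: chow_eq_0_iff chow_ideal_sum)

lemma finite_proper_flats: "finite (proper_flats E B)"
  using finite_flats by (rule rev_finite_subset) (auto simp: proper_flats_def)

lemma xvar_incomparable:
  "\<lbrakk>F \<in> proper_flats E B; F' \<in> proper_flats E B; \<not> F \<subseteq> F'; \<not> F' \<subseteq> F\<rbrakk> \<Longrightarrow> xvar F * xvar F' \<approx> 0"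
  unfolding chow_eq_0_iff chow_ideal_def ideal_gen_eq_span by (rule ideal.span_base) blast

lemma chow_alpha_eq: "\<lbrakk>i \<in> E; j \<in> E\<rbrakk> \<Longrightarrow> chow_alpha E B i \<approx> chow_alpha E B j"
  unfolding chow_eq_def chow_alpha_def chow_ideal_def ideal_gen_eq_span
  by (rule ideal.span_base) blast

section \<open>Relations among the classes \<open>h\<close> and straightening\<close>

lemma h_E: "h E = alpha"
proof -
  have "{G. is_flat E B G \<and> G \<noteq> E \<and> E \<subseteq> G} = {}" by (auto dest: flat_subset)
  then show ?thesis by (simp only: h_class_def sum.empty diff_0_right)
qed

lemma h_singleton: "i \<in> E \<Longrightarrow> h {i} \<approx> 0"
proof -
  assume i: "i \<in> E"
  have "{G. is_flat E B G \<and> G \<noteq> E \<and> {i} \<subseteq> G} = {F \<in> proper_flats E B. i \<in> F}"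
    by (auto simp: proper_flats_def)
  then have "h {i} = alpha - chow_alpha E B i"
    by (simp only: h_class_def chow_alpha_def)
  then show ?thesis using chow_alpha_eq[OF zero_in_E i] by (simp add: chow_eq_def)
qed

text \<open>Sets with the same closure lie in the same flats, so the polynomials are equal on the
  nose and not only modulo the ideal.\<close>

lemma h_cong:
  assumes "S \<subseteq> T" "T \<subseteq> E" "mrank B T \<le> mrank B S"
  shows "h S = h T"
proof -
  have "T \<subseteq> cl S"
  proof
    fix e assume e: "e \<in> T"
    have "mrank B S \<le> mrank B (insert e S)" "mrank B (insert e S) \<le> mrank B T"
      using e assms(1) by (auto intro!: mrank_mono)
    then show "e \<in> cl S" using e assms by (auto simp: cl_def)
  qed
  then have "S \<subseteq> G \<longleftrightarrow> T \<subseteq> G" if "is_flat E B G" for G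
    using cl_subset_flat[OF that, of S] assms(1) by blast
  then have "{G. is_flat E B G \<and> G \<noteq> E \<and> S \<subseteq> G} = {G. is_flat E B G \<and> G \<noteq> E \<and> T \<subseteq> G}"
    by (intro Collect_cong) metis
  then show ?thesis by (simp only: h_class_def)
qed

text \<open>\<open>h F - h (F \<union> F')\<close> is minus the sum of the variables of the proper
  flats that contain \<open>F\<close> but not \<open>F'\<close>. Such a flat is never nested with
  one that contains \<open>F'\<close> but not \<open>F\<close>, so the product expands into
  generators of the ideal. Nonempty \<open>F\<close> and \<open>F'\<close> ensure that these flats
  are nonempty.\<close>

lemma h_relation:
  assumes "F \<noteq> {}" "F' \<noteq> {}"
  shows "(h F - h (F \<union> F')) * (h F' - h (F \<union> F')) \<approx> 0"
proof -
  define X where "X S = {G. is_flat E B G \<and> G \<noteq> E \<and> S \<subseteq> G}" for S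
  have fin: "finite (X S)" for S
    using finite_flats by (rule rev_finite_subset) (auto simp: X_def)
  have h_diff: "h S - h (F \<union> F') = - sum xvar (X S - X (F \<union> F'))" if "S \<subseteq> F \<union> F'" for S
  proof -
    have "X (F \<union> F') \<subseteq> X S" using that by (auto simp: X_def)
    then have "sum xvar (X S - X (F \<union> F')) = sum xvar (X S) - sum xvar (X (F \<union> F'))"
      using fin by (intro sum_diff)
    moreover have "h T = alpha - sum xvar (X T)" for T by (simp only: h_class_def X_def)
    ultimately show ?thesis by (simp only:) simp
  qed
  have "(h F - h (F \<union> F')) * (h F' - h (F \<union> F')) =
      (\<Sum>G\<in>X F - X (F \<union> F'). \<Sum>G'\<in>X F' - X (F \<union> F'). xvar G * xvar G')"
    by (simp add: h_diff sum_product)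
  also have "\<dots> \<approx> 0"
  proof (intro chow_eq_sum_0 xvar_incomparable)
    fix G G' assume "G \<in> X F - X (F \<union> F')" "G' \<in> X F' - X (F \<union> F')"
    then show "G \<in> proper_flats E B" "G' \<in> proper_flats E B" "\<not> G \<subseteq> G'" "\<not> G' \<subseteq> G"
      using assms by (auto simp: X_def proper_flats_def)
  qed
  finally show ?thesis .
qed

text \<open>This is \<open>h_relation\<close> with \<open>F' = {e}\<close>, where
  \<open>h {e}\<close> vanishes.\<close>

lemma h_mult_h_insert:
  assumes "F \<noteq> {}" "e \<in> E"
  shows "h F * h (insert e F) \<approx> h (insert e F) * h (insert e F)"
proof -
  let ?U = "insert e F"
  have "(h F - h ?U) * (h {e} - h ?U) \<approx> 0"
    using h_relation[OF assms(1), of "{e}"] by simp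
  moreover have "(h F - h ?U) * h {e} \<approx> 0"
    using h_singleton[OF assms(2)] by (rule chow_eq_mult_zero)
  ultimately have "(h F - h ?U) * h {e} - (h F - h ?U) * (h {e} - h ?U) \<approx> 0 - 0"
    by (intro chow_eq_diff)
  then show ?thesis by (simp add: chow_eq_def algebra_simps)
qed

text \<open>A factor \<open>h F\<close> is promoted to \<open>h G\<close> in the presence of one
  factor \<open>h G\<close> per missing rank. For a point \<open>e\<close> raising the rank of
  \<open>F\<close>, the induction hypothesis is read backwards to expose
  \<open>h (insert e F)\<close>, and after \<open>h_mult_h_insert\<close> it is applied twice
  forwards.\<close>

lemma h_mult_h_power:
  assumes "G \<subseteq> E" "F \<subseteq> G" "F \<noteq> {}" "mrank B G \<le> mrank B F + r"
  shows "h F * h G ^ r \<approx> h G ^ Suc r"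
  using assms(2-)
proof (induction r arbitrary: F)
  case 0
  then show ?case using h_cong[of F G] assms(1) by simp
next
  case (Suc r)
  show ?case
  proof (cases "mrank B G \<le> mrank B F")
    case True
    then show ?thesis using h_cong[of F G] Suc.prems assms(1) by simp
  next
    case False
    have "finite G" using assms(1) finite_E finite_subset by auto
    then obtain e where e: "e \<in> G" "mrank B (insert e F) = Suc (mrank B F)"
      using exists_rank_increment[OF Suc.prems(1)] False by auto
    have IH: "h (insert e F) * h G ^ r \<approx> h G ^ Suc r"
      using e Suc.prems by (intro Suc.IH) auto
    have "h F * h G ^ Suc r \<approx> h F * (h (insert e F) * h G ^ r)"
      by (rule chow_eq_mult_left[OF chow_eq_sym[OF IH]])
    also have "\<dots> = (h F * h (insert e F)) * h G ^ r" by (simp add: mult_ac)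
    also have "\<dots> \<approx> (h (insert e F) * h (insert e F)) * h G ^ r"
      using e(1) assms(1) Suc.prems(2) by (intro chow_eq_mult_right h_mult_h_insert) auto
    also have "\<dots> = h (insert e F) * (h (insert e F) * h G ^ r)" by (simp add: mult_ac)
    also have "\<dots> \<approx> h (insert e F) * h G ^ Suc r" by (rule chow_eq_mult_left[OF IH])
    also have "\<dots> = h G * (h (insert e F) * h G ^ r)" by (simp add: mult_ac)
    also have "\<dots> \<approx> h G * h G ^ Suc r" by (rule chow_eq_mult_left[OF IH])
    finally show ?thesis by simp
  qed
qed

text \<open>A singleton in \<open>G\<close> has rank 1, so \<open>r - 1\<close> factors
  \<open>h G\<close> suffice to promote \<open>h {i}\<close>, which vanishes, to
  \<open>h G\<close>.\<close>

lemma h_power_eq_0: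
  assumes "G \<subseteq> E" "G \<noteq> {}" "mrank B G \<le> r"
  shows "h G ^ r \<approx> 0"
proof -
  obtain i where i: "i \<in> G" "i \<in> E" using assms by blast
  obtain s where s: "r = Suc s" using mrank_pos[OF assms(1,2)] assms(3) by (cases r) auto
  have "h G ^ Suc s \<approx> h {i} * h G ^ s"
    using assms i s mrank_singleton[OF i(2)] by (intro chow_eq_sym[OF h_mult_h_power]) auto
  also have "\<dots> \<approx> 0"
    using chow_eq_mult_zero[OF h_singleton[OF i(2)], of "h G ^ s"] by (simp only: mult.commute)
  finally show ?thesis by (simp only: s)
qed

text \<open>The inner measure drops whenever some \<open>S i\<close> grows inside \<open>G\<close>.
  Incomparable pairs grow by \<open>h_relation\<close>. If the sets form a chain, let
  \<open>F\<close> be the largest one other than \<open>G\<close>: either so many factors lie inside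
  \<open>F\<close> that their product vanishes, or there are enough factors \<open>h G\<close> to
  promote one \<open>h F\<close>. The bound on the rank of \<open>G\<close> makes these alternatives
  exhaustive.\<close>

lemma prod_h_eq_multiple_power:
  fixes S :: "'i \<Rightarrow> nat set"
  assumes "finite L" "G \<subseteq> E" "G \<noteq> {}" "\<forall>i\<in>L. S i \<noteq> {} \<and> S i \<subseteq> G" "mrank B G \<le> Suc (card L)"
  shows "\<exists>c. (\<Prod>i\<in>L. h (S i)) \<approx> Poly_Mapping.single 0 c * h G ^ card L"
  using assms
proof (induction "card G" arbitrary: G L S rule: less_induct)
  case less
  note outer_IH = less.hyps
  note fin = \<open>finite L\<close> and G = \<open>G \<subseteq> E\<close> \<open>G \<noteq> {}\<close> and rank = \<open>mrank B G \<le> Suc (card L)\<close>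
  have finG: "finite G" using G finite_E finite_subset by auto
  show ?case
    using \<open>\<forall>i\<in>L. S i \<noteq> {} \<and> S i \<subseteq> G\<close>
  proof (induction "\<Sum>i\<in>L. card (G - S i)" arbitrary: S rule: less_induct)
    case less
    note S = less.prems
    have smaller: "(\<Sum>i\<in>L. card (G - S' i)) < (\<Sum>i\<in>L. card (G - S i))"
      if "\<And>i. i \<in> L \<Longrightarrow> S i \<subseteq> S' i" "j \<in> L" "\<not> S' j \<subseteq> S j" "S' j \<subseteq> G" for S' j
    proof (rule sum_strict_mono_ex1)
      show "\<forall>i\<in>L. card (G - S' i) \<le> card (G - S i)"
        using that(1) finG by (auto intro!: card_mono)
      have "G - S' j \<subseteq> G - S j" "G - S' j \<noteq> G - S j" using that by auto
      then have "card (G - S' j) < card (G - S j)"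
        using finG by (intro psubset_card_mono) auto
      with that(2) show "\<exists>i\<in>L. card (G - S' i) < card (G - S i)" by blast
    qed (rule fin)
    show ?case
    proof (cases "\<forall>i\<in>L. \<forall>j\<in>L. S i \<subseteq> S j \<or> S j \<subseteq> S i")
      case False
      then obtain i j where ij: "i \<in> L" "j \<in> L" "\<not> S i \<subseteq> S j" "\<not> S j \<subseteq> S i" by blast
      then have "i \<noteq> j" by auto
      define U where "U = S i \<union> S j"
      define R where "R = (\<Prod>k\<in>L - {i} - {j}. h (S k))"
      have U: "U \<noteq> {}" "U \<subseteq> G" using S ij by (auto simp: U_def)
      have split: "(\<Prod>k\<in>L. h (S' k)) = h (S' i) * h (S' j) * R"
        if "\<And>k. k \<noteq> i \<Longrightarrow> k \<noteq> j \<Longrightarrow> S' k = S k" for S'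
      proof -
        have "(\<Prod>k\<in>L. h (S' k)) = h (S' i) * (\<Prod>k\<in>L - {i}. h (S' k))"
          using fin ij by (intro prod.remove)
        also have "(\<Prod>k\<in>L - {i}. h (S' k)) = h (S' j) * (\<Prod>k\<in>L - {i} - {j}. h (S' k))"
          using fin ij \<open>i \<noteq> j\<close> by (intro prod.remove) auto
        also have "(\<Prod>k\<in>L - {i} - {j}. h (S' k)) = R"
          unfolding R_def by (intro prod.cong) (auto simp: that)
        finally show ?thesis by (simp only: mult.assoc)
      qed
      have "\<exists>c. (\<Prod>k\<in>L. h ((S(j := U)) k)) \<approx> Poly_Mapping.single 0 c * h G ^ card L"
        using S U ij by (intro less.hyps smaller[of _ j]) (auto simp: U_def)
      then obtain c1 where c1: "h (S i) * h U * R \<approx> Poly_Mapping.single 0 c1 * h G ^ card L"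
        using split[of "S(j := U)"] \<open>i \<noteq> j\<close> by auto
      have "\<exists>c. (\<Prod>k\<in>L. h ((S(i := U)) k)) \<approx> Poly_Mapping.single 0 c * h G ^ card L"
        using S U ij by (intro less.hyps smaller[of _ i]) (auto simp: U_def)
      then obtain c2 where c2: "h U * h (S j) * R \<approx> Poly_Mapping.single 0 c2 * h G ^ card L"
        using split[of "S(i := U)"] \<open>i \<noteq> j\<close> by auto
      have "\<exists>c. (\<Prod>k\<in>L. h ((S(i := U, j := U)) k)) \<approx> Poly_Mapping.single 0 c * h G ^ card L"
        using S U ij by (intro less.hyps smaller[of _ i]) (auto simp: U_def)
      then obtain c3 where c3: "h U * h U * R \<approx> Poly_Mapping.single 0 c3 * h G ^ card L"
        using split[of "S(i := U, j := U)"] \<open>i \<noteq> j\<close> by auto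
      \<comment> \<open>The quadratic relation is solved for \<open>h (S i) * h (S j)\<close>; the
        other three terms contain \<open>U\<close> and are covered by the induction.\<close>
      have "R * ((h (S i) - h U) * (h (S j) - h U)) \<approx> 0"
        unfolding U_def using S ij by (intro chow_eq_mult_zero h_relation) auto
      then have "h (S i) * h (S j) * R \<approx> h (S i) * h U * R + h U * h (S j) * R - h U * h U * R"
        by (simp add: chow_eq_def algebra_simps)
      also have "\<dots> \<approx> Poly_Mapping.single 0 c1 * h G ^ card L + Poly_Mapping.single 0 c2 * h G ^ card L
          - Poly_Mapping.single 0 c3 * h G ^ card L"
        using c1 c2 c3 by (intro chow_eq_add chow_eq_diff)
      also have "\<dots> = Poly_Mapping.single 0 (c1 + c2 - c3) * h G ^ card L"
        by (simp add: single_add single_diff algebra_simps)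
      finally show ?thesis using split[of S] by auto
    next
      case chain: True
      define L' where "L' = {i \<in> L. S i \<noteq> G}"
      have finL': "finite L'" "L' \<subseteq> L" using fin by (auto simp: L'_def)
      have rest: "(\<Prod>i\<in>L. h (S i)) = (\<Prod>i\<in>L'. h (S i)) * h G ^ card (L - L')"
      proof -
        have "(\<Prod>i\<in>L. h (S i)) = (\<Prod>i\<in>L - L'. h (S i)) * (\<Prod>i\<in>L'. h (S i))"
          using fin finL' by (intro prod.subset_diff)
        also have "(\<Prod>i\<in>L - L'. h (S i)) = h G ^ card (L - L')"
          by (subst prod.cong[OF refl, of _ _ "\<lambda>_. h G"]) (auto simp: L'_def)
        finally show ?thesis by (simp add: mult_ac)
      qed
      show ?thesis
      proof (cases "L' = {}")
        case True
        then have "(\<Prod>i\<in>L. h (S i)) = Poly_Mapping.single 0 1 * h G ^ card L" using rest by simp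
        then show ?thesis by (metis chow_eq_refl)
      next
        case False
        then have "Max ((\<lambda>i. card (S i)) ` L') \<in> (\<lambda>i. card (S i)) ` L'"
          using finL' by (intro Max_in) auto
        then obtain m where m: "m \<in> L'" "card (S m) = Max ((\<lambda>i. card (S i)) ` L')" by auto
        define F where "F = S m"
        have F: "F \<noteq> {}" "F \<subseteq> G" "F \<noteq> G" using m S by (auto simp: F_def L'_def)
        have finF: "finite F" using F finG finite_subset by auto
        have S_F: "S i \<subseteq> F" if "i \<in> L'" for i
        proof (rule ccontr)
          assume no: "\<not> S i \<subseteq> F"
          then have "F \<subseteq> S i" "F \<noteq> S i" using chain m(1) that finL' by (auto simp: F_def)
          moreover have "finite (S i)" using S that finL' finG finite_subset by blast
          ultimately have "card F < card (S i)" by (intro psubset_card_mono) auto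
          moreover have "card (S i) \<le> card F" using finL' that by (simp add: F_def m(2))
          ultimately show False by simp
        qed
        have cardL: "card L = card L' + card (L - L')"
          using fin finL' by (metis card_Diff_subset card_mono le_add_diff_inverse)
        show ?thesis
        proof (cases "mrank B F \<le> card L'")
          \<comment> \<open>The outer induction inside \<open>F\<close> gives a multiple of
            \<open>h F ^ card L'\<close>, whose exponent has reached the rank of
            \<open>F\<close>.\<close>
          case True
          have "card F < card G" using F finG by (intro psubset_card_mono) auto
          moreover have "F \<subseteq> E" using F(2) G(1) by (rule subset_trans)
          moreover have nonempty: "\<forall>i\<in>L'. S i \<noteq> {} \<and> S i \<subseteq> F" using S S_F finL'(2) by blast
          ultimately obtain c where "(\<Prod>i\<in>L'. h (S i)) \<approx> Poly_Mapping.single 0 c * h F ^ card L'"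
            using outer_IH[of F L' S] F(1) True finL'(1) nonempty by auto
          also have "\<dots> \<approx> 0"
            using \<open>F \<subseteq> E\<close> F(1) True by (intro chow_eq_mult_zero h_power_eq_0)
          finally have "h G ^ card (L - L') * (\<Prod>i\<in>L'. h (S i)) \<approx> 0" by (rule chow_eq_mult_zero)
          then have "(\<Prod>i\<in>L. h (S i)) \<approx> Poly_Mapping.single 0 0 * h G ^ card L"
            by (simp add: rest mult_ac)
          then show ?thesis by blast
        next
          case False
          define r where "r = card (L - L')"
          define R where "R = (\<Prod>i\<in>L' - {m}. h (S i))"
          \<comment> \<open>The rank of \<open>F\<close> is at least \<open>card L' + 1\<close> and
            that of \<open>G\<close> at most \<open>card L + 1\<close>.\<close>
          have "mrank B G \<le> mrank B F + r" using False rank cardL by (simp add: r_def)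
          then have absorb: "h F * h G ^ r \<approx> h G ^ Suc r" using F G by (intro h_mult_h_power)
          have "(\<Prod>i\<in>L. h (S i)) = R * (h F * h G ^ r)"
            unfolding rest R_def r_def F_def using finL' m(1) by (simp add: prod.remove[of _ m] mult_ac)
          also have "\<dots> \<approx> R * h G ^ Suc r" by (rule chow_eq_mult_left[OF absorb])
          also have "\<dots> = (\<Prod>i\<in>L. h ((S(m := G)) i))"
          proof -
            have "(\<Prod>i\<in>L. h ((S(m := G)) i)) =
                (\<Prod>i\<in>L - L'. h ((S(m := G)) i)) * (\<Prod>i\<in>L'. h ((S(m := G)) i))"
              using fin finL' by (intro prod.subset_diff)
            also have "(\<Prod>i\<in>L - L'. h ((S(m := G)) i)) = h G ^ r"
              by (subst prod.cong[OF refl, of _ _ "\<lambda>_. h G"]) (auto simp: L'_def r_def)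
            also have "(\<Prod>i\<in>L'. h ((S(m := G)) i)) = h G * (\<Prod>i\<in>L' - {m}. h ((S(m := G)) i))"
              using finL' m(1) by (simp add: prod.remove[of _ m])
            also have "(\<Prod>i\<in>L' - {m}. h ((S(m := G)) i)) = R"
              unfolding R_def by (rule prod.cong) auto
            finally show ?thesis by (simp add: mult_ac)
          qed
          finally have eq: "(\<Prod>i\<in>L. h (S i)) \<approx> (\<Prod>i\<in>L. h ((S(m := G)) i))" .
          have "\<exists>c. (\<Prod>i\<in>L. h ((S(m := G)) i)) \<approx> Poly_Mapping.single 0 c * h G ^ card L"
            using S F G m(1) finL' by (intro less.hyps smaller[of _ m]) (auto simp: F_def)
          with eq show ?thesis by (meson chow_eq_trans)
        qed
      qed
    qed
  qed
qed

end

section \<open>Maximal chains of flats and powers of alpha\<close>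

context chow_matroid
begin

lemma flat_empty: "is_flat E B {}"
  by (simp add: is_flat_def mrank_singleton)

text \<open>One factor \<open>alpha\<close> may be expanded at any point; a well-chosen
  \<open>i\<close> makes most terms vanish.\<close>

lemma alpha_power_mult_cong:
  "i \<in> E \<Longrightarrow> alpha ^ Suc j * p \<approx> alpha ^ j * (\<Sum>G\<in>{G \<in> proper_flats E B. i \<in> G}. xvar G * p)"
proof -
  assume i: "i \<in> E"
  have "(alpha ^ j * p) * alpha \<approx> (alpha ^ j * p) * chow_alpha E B i"
    using i by (intro chow_eq_mult_left chow_alpha_eq zero_in_E)
  then show ?thesis by (simp add: chow_alpha_def sum_distrib_left sum_distrib_right mult_ac)
qed

text \<open>Expand one \<open>alpha\<close> at a point outside \<open>F\<close>. A flat containing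
  that point and comparable with \<open>F\<close> lies strictly above \<open>F\<close>, so the rank
  gained pays for the lost factor.\<close>

lemma alpha_power_mult_xvar_eq_0:
  "\<lbrakk>F \<in> proper_flats E B; d < mrank B F + j\<rbrakk> \<Longrightarrow> alpha ^ j * xvar F \<approx> 0"
proof (induction j arbitrary: F)
  case 0
  then show ?case using proper_flat_mrank_le[of F] by simp
next
  case (Suc j)
  obtain i where i: "i \<in> E" "i \<notin> F"
    using Suc.prems(1) by (auto simp: proper_flats_def dest: flat_subset)
  have "alpha ^ Suc j * xvar F \<approx>
      alpha ^ j * (\<Sum>G\<in>{G \<in> proper_flats E B. i \<in> G}. xvar G * xvar F)"
    using i(1) by (rule alpha_power_mult_cong)
  also have "\<dots> = (\<Sum>G\<in>{G \<in> proper_flats E B. i \<in> G}. alpha ^ j * (xvar G * xvar F))"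
    by (rule sum_distrib_left)
  also have "\<dots> \<approx> 0"
  proof (rule chow_eq_sum_0)
    fix G assume "G \<in> {G \<in> proper_flats E B. i \<in> G}"
    then have G: "G \<in> proper_flats E B" "i \<in> G" by auto
    show "alpha ^ j * (xvar G * xvar F) \<approx> 0"
    proof (cases "F \<subseteq> G")
      case False
      moreover have "\<not> G \<subseteq> F" using G i by auto
      ultimately show ?thesis
        using G(1) Suc.prems(1) by (intro chow_eq_mult_zero xvar_incomparable)
    next
      case True
      then have "mrank B F < mrank B G"
        using flat_mrank_less[of F G] G i Suc.prems(1)
        by (auto simp: proper_flats_def psubset_eq dest: flat_subset)
      then have "alpha ^ j * xvar G \<approx> 0" using Suc.prems(2) G(1) by (intro Suc.IH) auto
      then have "xvar F * (alpha ^ j * xvar G) \<approx> 0" by (rule chow_eq_mult_zero)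
      then show ?thesis by (simp add: mult_ac)
    qed
  qed
  finally show ?case .
qed

text \<open>Let \<open>G\<close> be the next member of \<open>C\<close> above \<open>F0\<close>, or
  \<open>E\<close> if there is none. Closing \<open>F0\<close> with one point of \<open>G\<close>
  gives a flat between \<open>F0\<close> and \<open>G\<close>, comparable with all of
  \<open>C\<close>, so maximality forces it into \<open>C\<close>. The point \<open>i\<close> is
  returned because \<open>alpha\<close> will be expanded there.\<close>

lemma maximal_flat_chain_extend:
  assumes C: "maximal_flat_chain E B C" and F0: "is_flat E B F0" "F0 = {} \<or> F0 \<in> C"
    and rank: "mrank B F0 < d"
  obtains F i where "F \<in> C" "i \<in> F - F0" "mrank B F = Suc (mrank B F0)" "F = cl (insert i F0)"
proof -
  define U where "U = insert E {F \<in> C. F0 \<subset> F}"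
  have chain: "F \<in> C \<Longrightarrow> F \<in> proper_flats E B" "F \<in> C \<Longrightarrow> F' \<in> C \<Longrightarrow> F \<subseteq> F' \<or> F' \<subseteq> F" for F F'
    using C by (auto simp: maximal_flat_chain_def flat_chain_def)
  have "finite C" using chain(1) by (intro finite_subset[OF _ finite_proper_flats]) blast
  then have "finite U" "U \<noteq> {}" by (simp_all add: U_def)
  then obtain G where G: "G \<in> U" "\<And>F. \<lbrakk>F \<in> U; F \<subseteq> G\<rbrakk> \<Longrightarrow> F = G"
    using finite_has_minimal[of U] by metis
  have flatG: "is_flat E B G"
    using G(1) flat_E chain(1) by (auto simp: U_def proper_flats_def)
  have "F0 \<noteq> E" using rank mrank_E by auto
  then have "F0 \<subseteq> G" "F0 \<noteq> G"
    using G(1) flat_subset[OF F0(1)] by (auto simp: U_def)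
  note F0_G = this(1) flat_subset[OF flatG]
  obtain i where i: "i \<in> G" "i \<notin> F0" using \<open>F0 \<subseteq> G\<close> \<open>F0 \<noteq> G\<close> by blast
  define F where "F = cl (insert i F0)"
  have sub: "insert i F0 \<subseteq> E" using i F0_G by auto
  have F: "is_flat E B F" "insert i F0 \<subseteq> F" "F \<subseteq> G"
    using flat_cl[OF sub] subset_cl[OF sub] cl_subset_flat[OF flatG, of "insert i F0"] i F0_G
    by (auto simp: F_def)
  have rankF: "mrank B F = Suc (mrank B F0)"
  proof -
    have "mrank B F0 < mrank B (insert i F0)" using F0(1) i sub by (auto simp: is_flat_def)
    then show ?thesis
      using mrank_insert_le[of i F0] mrank_cl[OF sub] by (simp add: F_def)
  qed
  then have "F \<in> proper_flats E B"
    using F rank mrank_E by (auto simp: proper_flats_def)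
  moreover have "F' \<subseteq> F \<or> F \<subseteq> F'" if "F' \<in> C" for F'
  proof (cases "F0 \<subset> F'")
    case True
    then have "F' \<in> U" using that by (simp add: U_def)
    moreover have "G \<subseteq> F' \<or> F' \<subseteq> G"
      using G(1) chain that by (auto simp: U_def proper_flats_def dest: flat_subset)
    ultimately have "G \<subseteq> F'" using G(2)[of F'] by blast
    then show ?thesis using F by auto
  next
    case False
    then have "F' \<subseteq> F0" using F0(2) chain(2)[OF that, of F0] chain(1)[OF that]
      by (auto simp: psubset_eq)
    then show ?thesis using F by auto
  qed
  ultimately have "flat_chain E B (insert F C)"
    using chain by (auto simp: flat_chain_def)
  then have "F \<in> C" using C unfolding maximal_flat_chain_def by blast
  then show ?thesis using that[of F i] i F rankF by (auto simp: F_def)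
qed

text \<open>Factors \<open>alpha\<close> are traded for chain members in order of rank. With
  \<open>alpha\<close> expanded at \<open>i \<in> F1 - F0\<close>, a flat not above
  \<open>F0\<close> is incomparable with \<open>F0\<close>. A flat above \<open>F0\<close> contains
  \<open>F1\<close>, and if it is larger, its rank is too high for the remaining power of
  \<open>alpha\<close>.\<close>

lemma alpha_power_eq_maximal_chain:
  assumes C: "maximal_flat_chain E B C"
  shows "alpha ^ d \<approx> (\<Prod>F\<in>C. xvar F)"
proof -
  have chain: "F \<in> C \<Longrightarrow> F \<in> proper_flats E B" "F \<in> C \<Longrightarrow> F' \<in> C \<Longrightarrow> F \<subseteq> F' \<or> F' \<subseteq> F" for F F'
    using C by (auto simp: maximal_flat_chain_def flat_chain_def)
  have finC: "finite C" using chain(1) by (intro finite_subset[OF _ finite_proper_flats]) blast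
  have flats: "is_flat E B F" "F \<subseteq> E" "F \<noteq> {}" if "F \<in> C" for F
    using chain(1)[OF that] by (auto simp: proper_flats_def dest: flat_subset)
  have nested: "F \<subseteq> G" if "F \<in> C" "G \<in> C" "mrank B F \<le> mrank B G" for F G
    using chain(2)[OF that(1,2)] flat_mrank_less[OF flats(1)[OF that(2)], of F] flats(2)[OF that(1)] that(3)
    by (auto simp: psubset_eq)
  define below where "below k = {F \<in> C. mrank B F \<le> k}" for k
  have "\<exists>F0. is_flat E B F0 \<and> (F0 = {} \<or> F0 \<in> C) \<and> mrank B F0 = k \<and>
      alpha ^ d \<approx> alpha ^ (d - k) * (\<Prod>F\<in>below k. xvar F)" if "k \<le> d" for k
    using that
  proof (induction k)
    case 0
    have "mrank B F \<noteq> 0" if "F \<in> C" for F using mrank_pos[OF flats(2,3)[OF that]] by simp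
    then have "below 0 = {}" by (simp add: below_def)
    then show ?case using flat_empty by (intro exI[of _ "{}"]) simp
  next
    case (Suc k)
    then obtain F0 where F0: "is_flat E B F0" "F0 = {} \<or> F0 \<in> C" "mrank B F0 = k"
      and IH: "alpha ^ d \<approx> alpha ^ (d - k) * (\<Prod>F\<in>below k. xvar F)" by auto
    obtain F1 i where F1: "F1 \<in> C" "i \<in> F1 - F0" "mrank B F1 = Suc k" "F1 = cl (insert i F0)"
      using maximal_flat_chain_extend[OF C F0(1,2)] F0(3) Suc.prems by auto
    define P where "P = (\<Prod>F\<in>below k. xvar F)"
    define j where "j = d - Suc k"
    have j: "d - k = Suc j" using Suc.prems by (simp add: j_def)
    have below_Suc: "below (Suc k) = insert F1 (below k)"
    proof -
      have "F = F1" if "F \<in> C" "mrank B F = Suc k" for F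
        using nested[of F F1] nested[of F1 F] that F1(1,3) by auto
      then show ?thesis using F1(1,3) unfolding below_def le_Suc_eq by blast
    qed
    have P_Suc: "(\<Prod>F\<in>below (Suc k). xvar F) = xvar F1 * P"
      unfolding below_Suc P_def using F1(3) finC by (subst prod.insert) (auto simp: below_def)
    have iE: "i \<in> E" using F1(2) flats(2)[OF F1(1)] by blast
    let ?X = "{G \<in> proper_flats E B. i \<in> G}"
    have F1X: "F1 \<in> ?X" using F1(2) chain(1)[OF F1(1)] by simp
    have vanish: "alpha ^ j * (xvar G * P) \<approx> 0" if "G \<in> ?X - {F1}" for G
    proof (cases "F0 \<subseteq> G")
      case False
      then have F0C: "F0 \<in> C" using F0(2) by auto
      have "F0 \<in> below k" "finite (below k)" using F0 F0C finC by (auto simp: below_def)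
      then have "P = xvar F0 * (\<Prod>F\<in>below k - {F0}. xvar F)"
        unfolding P_def by (metis prod.remove)
      moreover have "xvar G * xvar F0 \<approx> 0"
        using that chain(1)[OF F0C] F1(2) False by (intro xvar_incomparable) auto
      then have "(alpha ^ j * (\<Prod>F\<in>below k - {F0}. xvar F)) * (xvar G * xvar F0) \<approx> 0"
        by (rule chow_eq_mult_zero)
      ultimately show ?thesis by (simp add: mult_ac)
    next
      case True
      have G: "is_flat E B G" "G \<subseteq> E" "G \<in> proper_flats E B" "G \<noteq> F1" "i \<in> G"
        using that by (auto simp: proper_flats_def dest: flat_subset)
      then have "F1 \<subset> G"
        using cl_subset_flat[of G "insert i F0"] True F1(4) by (auto simp: psubset_eq)
      then have "Suc k < mrank B G" using flat_mrank_less[OF flats(1)[OF F1(1)], of G] F1(3) G(2) by simp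
      then have "alpha ^ j * xvar G \<approx> 0"
        using G(3) Suc.prems by (intro alpha_power_mult_xvar_eq_0) (auto simp: j_def)
      then have "P * (alpha ^ j * xvar G) \<approx> 0" by (rule chow_eq_mult_zero)
      then show ?thesis by (simp add: mult_ac)
    qed
    have "alpha ^ d \<approx> alpha ^ Suc j * P" using IH by (simp only: j P_def)
    also have "\<dots> \<approx> alpha ^ j * (\<Sum>G\<in>?X. xvar G * P)" using iE by (rule alpha_power_mult_cong)
    also have "\<dots> = alpha ^ j * (xvar F1 * P) + (\<Sum>G\<in>?X - {F1}. alpha ^ j * (xvar G * P))"
      using F1X finite_proper_flats
      by (subst sum.remove[of _ F1]) (auto simp: distrib_left sum_distrib_left)
    also have "\<dots> \<approx> alpha ^ j * (xvar F1 * P) + 0"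
      using vanish by (intro chow_eq_add chow_eq_refl chow_eq_sum_0)
    finally have "alpha ^ d \<approx> alpha ^ (d - Suc k) * (\<Prod>F\<in>below (Suc k). xvar F)"
      by (simp add: P_Suc j_def)
    with F1(1,3) flats(1)[OF F1(1)] show ?case by blast
  qed
  from this[of d] have "alpha ^ d \<approx> (\<Prod>F\<in>below d. xvar F)" by auto
  moreover have "below d = C" using proper_flat_mrank_le chain(1) by (auto simp: below_def)
  ultimately show ?thesis by simp
qed

lemma exists_maximal_flat_chain: "\<exists>C. maximal_flat_chain E B C"
proof -
  let ?Q = "{C. flat_chain E B C}"
  have "?Q \<subseteq> Pow (proper_flats E B)" by (auto simp: flat_chain_def)
  then have "finite ?Q" by (rule finite_subset) (simp add: finite_proper_flats)
  moreover have "{} \<in> ?Q" by (simp add: flat_chain_def)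
  ultimately obtain C where "C \<in> ?Q" "\<And>C'. C' \<in> ?Q \<Longrightarrow> C \<subseteq> C' \<Longrightarrow> C = C'"
    using finite_has_maximal[of ?Q] by auto
  then show ?thesis unfolding maximal_flat_chain_def by blast
qed

end

section \<open>Zeta inversion and polynomial substitution\<close>

text \<open>Moebius inversion as an existence statement. A minimal element occurs in no sum but its
  own, so its value can be fixed last.\<close>

lemma zeta_inversion:
  fixes g :: "'a::order \<Rightarrow> 'b::ab_group_add"
  assumes "finite A"
  shows "\<exists>p. \<forall>x\<in>A. (\<Sum>y\<in>{y \<in> A. x \<le> y}. p y) = g x"
  using assms
proof (induction "card A" arbitrary: A)
  case 0
  then show ?case by simp
next
  case (Suc n)
  then have "A \<noteq> {}" by auto
  then obtain m where m: "m \<in> A" "\<And>x. \<lbrakk>x \<in> A; x \<le> m\<rbrakk> \<Longrightarrow> x = m"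
    using finite_has_minimal[OF \<open>finite A\<close>] by metis
  define A' where "A' = A - {m}"
  have "n = card A'" "finite A'" using Suc m by (simp_all add: A'_def)
  then obtain p where p: "\<And>x. x \<in> A' \<Longrightarrow> (\<Sum>y\<in>{y \<in> A'. x \<le> y}. p y) = g x"
    using Suc.hyps(1) by metis
  define q where "q = p(m := g m - (\<Sum>y\<in>{y \<in> A'. m \<le> y}. p y))"
  have q_p: "(\<Sum>y\<in>{y \<in> A'. x \<le> y}. q y) = (\<Sum>y\<in>{y \<in> A'. x \<le> y}. p y)" for x
    by (rule sum.cong) (auto simp: q_def A'_def)
  have "(\<Sum>y\<in>{y \<in> A. x \<le> y}. q y) = g x" if x: "x \<in> A" for x
  proof (cases "x = m")
    case True
    have "{y \<in> A. m \<le> y} = insert m {y \<in> A'. m \<le> y}" using m(1) by (auto simp: A'_def)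
    then have "(\<Sum>y\<in>{y \<in> A. m \<le> y}. q y) = q m + (\<Sum>y\<in>{y \<in> A'. m \<le> y}. q y)"
      using \<open>finite A'\<close> by (simp add: A'_def)
    then show ?thesis unfolding True q_p by (simp add: q_def)
  next
    case False
    have "{y \<in> A. x \<le> y} = {y \<in> A'. x \<le> y}" using m(2)[of x] x False by (auto simp: A'_def)
    then show ?thesis using p[of x] q_p[of x] x False by (simp add: A'_def)
  qed
  then show ?case by blast
qed

section \<open>Substitution homomorphisms of polynomial rings\<close>

lemma poly_mapping_eq_sum_single:
  "p = (\<Sum>m\<in>Poly_Mapping.keys p. Poly_Mapping.single m (Poly_Mapping.lookup p m))"
proof (rule poly_mapping_eqI)
  fix k
  have "Poly_Mapping.lookup (\<Sum>m\<in>Poly_Mapping.keys p. Poly_Mapping.single m (Poly_Mapping.lookup p m)) k =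
      (\<Sum>m\<in>Poly_Mapping.keys p. if m = k then Poly_Mapping.lookup p m else 0)"
    unfolding lookup_sum lookup_single when_def ..
  also have "\<dots> = Poly_Mapping.lookup p k"
    by (simp add: in_keys_iff)
  finally show "Poly_Mapping.lookup p k =
    Poly_Mapping.lookup (\<Sum>m\<in>Poly_Mapping.keys p. Poly_Mapping.single m (Poly_Mapping.lookup p m)) k" ..
qed

text \<open>Shared source of the additivity of \<open>poly_subst\<close> and \<open>hdeg\<close>:
  since \<open>f m 0 = 0\<close>, all sums may run over the union of both supports.\<close>

lemma sum_keys_lookup_add:
  fixes p q :: "'a \<Rightarrow>\<^sub>0 'b::semiring_0" and f :: "'a \<Rightarrow> 'b \<Rightarrow> 'c::comm_monoid_add"
  assumes "\<And>m. f m 0 = 0" "\<And>m a b. f m (a + b) = f m a + f m b"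
  shows "(\<Sum>m\<in>Poly_Mapping.keys (p + q). f m (Poly_Mapping.lookup (p + q) m)) =
    (\<Sum>m\<in>Poly_Mapping.keys p. f m (Poly_Mapping.lookup p m)) +
    (\<Sum>m\<in>Poly_Mapping.keys q. f m (Poly_Mapping.lookup q m))"
proof -
  let ?A = "Poly_Mapping.keys p \<union> Poly_Mapping.keys q"
  have *: "(\<Sum>m\<in>Poly_Mapping.keys r. f m (Poly_Mapping.lookup r m)) = (\<Sum>m\<in>?A. f m (Poly_Mapping.lookup r m))"
    if "Poly_Mapping.keys r \<subseteq> ?A" for r
    using that assms(1) by (intro sum.mono_neutral_left) (auto simp: in_keys_iff)
  show ?thesis
    using *[of p] *[of q] *[of "p + q"] keys_add[of p q]
    by (simp add: lookup_add assms(2) sum.distrib)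
qed

lemma prod_single:
  "(\<Prod>i\<in>I. Poly_Mapping.single (m i) (1 :: 'c::comm_semiring_1)) = Poly_Mapping.single (\<Sum>i\<in>I. m i) 1"
  by (induction I rule: infinite_finite_induct) (simp_all add: mult_single)

definition monom_subst :: "('a \<Rightarrow> 'b::comm_monoid_mult) \<Rightarrow> ('a \<Rightarrow>\<^sub>0 nat) \<Rightarrow> 'b" where
  "monom_subst q m = (\<Prod>x\<in>Poly_Mapping.keys m. q x ^ Poly_Mapping.lookup m x)"

lemma monom_subst_add: "monom_subst q (m + m') = monom_subst q m * monom_subst q m'"
proof -
  let ?A = "Poly_Mapping.keys m \<union> Poly_Mapping.keys m'"
  have *: "monom_subst q k = (\<Prod>x\<in>?A. q x ^ Poly_Mapping.lookup k x)" if "Poly_Mapping.keys k \<subseteq> ?A" for k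
    unfolding monom_subst_def using that by (intro prod.mono_neutral_left) (auto simp: in_keys_iff)
  show ?thesis
    using *[of m] *[of m'] *[of "m + m'"] keys_add[of m m']
    by (simp add: lookup_add power_add prod.distrib)
qed

lemma monom_subst_0 [simp]: "monom_subst q 0 = 1"
  by (simp add: monom_subst_def)

text \<open>The target has exponents in an arbitrary commutative monoid, so that multisets can serve
  as monomials there.\<close>

definition poly_subst ::
  "('a \<Rightarrow> 'b \<Rightarrow>\<^sub>0 'c) \<Rightarrow> (('a \<Rightarrow>\<^sub>0 nat) \<Rightarrow>\<^sub>0 'c) \<Rightarrow> ('b::comm_monoid_add \<Rightarrow>\<^sub>0 'c::comm_ring_1)" where
  "poly_subst q p = (\<Sum>m\<in>Poly_Mapping.keys p. Poly_Mapping.single 0 (Poly_Mapping.lookup p m) * monom_subst q m)"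

lemma poly_subst_0 [simp]: "poly_subst q 0 = 0"
  by (simp add: poly_subst_def)

lemma poly_subst_add: "poly_subst q (p + p') = poly_subst q p + poly_subst q p'"
  unfolding poly_subst_def
  by (rule sum_keys_lookup_add) (simp_all add: single_add distrib_right)

lemma poly_subst_diff: "poly_subst q (p - p') = poly_subst q p - poly_subst q p'"
  using poly_subst_add[of q "p - p'" p'] by (simp add: algebra_simps)

lemma poly_subst_sum: "poly_subst q (sum f I) = (\<Sum>i\<in>I. poly_subst q (f i))"
  by (induction I rule: infinite_finite_induct) (simp_all add: poly_subst_add)

lemma poly_subst_single: "poly_subst q (Poly_Mapping.single m c) = Poly_Mapping.single 0 c * monom_subst q m"
  by (simp add: poly_subst_def)

lemma poly_subst_mult:
  fixes q :: "'a \<Rightarrow> 'b::comm_monoid_add \<Rightarrow>\<^sub>0 'c::comm_ring_1"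
  shows "poly_subst q (p * p') = poly_subst q p * poly_subst q p'"
proof -
  have "poly_subst q (Poly_Mapping.single m c * Poly_Mapping.single m' c') =
      poly_subst q (Poly_Mapping.single m c) * poly_subst q (Poly_Mapping.single m' c')" for m c m' c'
  proof -
    have eq: "Poly_Mapping.single (0::'b) (c * c') = Poly_Mapping.single 0 c * Poly_Mapping.single 0 c'"
      by (simp add: mult_single)
    show ?thesis
      unfolding mult_single[of m] poly_subst_single monom_subst_add eq by (simp only: mult_ac)
  qed
  then show ?thesis
    by (subst (1 2) poly_mapping_eq_sum_single[of p], subst (1 2) poly_mapping_eq_sum_single[of p'])
      (simp only: sum_product poly_subst_sum)
qed

lemma poly_subst_1 [simp]: "poly_subst q 1 = 1"
  using poly_subst_single[of q 0 1] by simp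

lemma poly_subst_prod: "poly_subst q (prod f I) = (\<Prod>i\<in>I. poly_subst q (f i))"
  by (induction I rule: infinite_finite_induct) (simp_all add: poly_subst_mult)

lemma poly_subst_xvar: "poly_subst q (xvar F) = q F"
  by (simp add: xvar_def poly_subst_single monom_subst_def)

section \<open>The dragon functional\<close>

text \<open>With multisets as monomials, repeated factors are kept apart and multiset inclusion is
  passage to a subfamily.\<close>

type_synonym hpoly = "nat set multiset \<Rightarrow>\<^sub>0 real"

abbreviation hvar :: "nat set \<Rightarrow> hpoly" where
  "hvar S \<equiv> Poly_Mapping.single {#S#} 1"

text \<open>Subfamilies split according to whether they use the new copy of \<open>S\<close>; this
  yields recursions for the dragon conditions.\<close>

lemma subseteq_add_mset_cases:
  "(\<forall>J. J \<subseteq># add_mset S N \<longrightarrow> P J) \<longleftrightarrow> (\<forall>J. J \<subseteq># N \<longrightarrow> P J) \<and> (\<forall>J. J \<subseteq># N \<longrightarrow> P (add_mset S J))"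
proof (intro iffI conjI allI impI)
  fix J assume *: "(\<forall>J. J \<subseteq># N \<longrightarrow> P J) \<and> (\<forall>J. J \<subseteq># N \<longrightarrow> P (add_mset S J))"
    and J: "J \<subseteq># add_mset S N"
  show "P J"
  proof (cases "S \<in># J")
    case True
    then obtain J' where J': "J = add_mset S J'" by (metis insert_DiffM)
    then show ?thesis using J * by simp
  next
    case False
    then have "J \<subseteq># N" using J by (metis diff_single_trivial subset_eq_diff_conv union_mset_add_mset_right add.right_neutral)
    then show ?thesis using * by blast
  qed
next
  fix J assume "\<forall>J. J \<subseteq># add_mset S N \<longrightarrow> P J" "J \<subseteq># N"
  moreover have "N \<subseteq># add_mset S N" by (metis add_mset_add_single mset_subset_eq_add_left)
  ultimately show "P J" by (meson subset_mset.order_trans)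
qed simp

context loopless_matroid
begin

text \<open>What DHR still demands of \<open>N\<close> once some factors with union \<open>X\<close>
  are in the subfamily; \<open>k\<close> is their number plus one.\<close>

definition dragon_above :: "nat set \<Rightarrow> nat \<Rightarrow> nat set multiset \<Rightarrow> bool" where
  "dragon_above X k N \<longleftrightarrow> (\<forall>J. J \<subseteq># N \<longrightarrow> size J + k \<le> mrank B (X \<union> \<Union> (set_mset J)))"

definition dragon :: "nat set multiset \<Rightarrow> bool" where
  "dragon N \<longleftrightarrow> (\<forall>J. J \<subseteq># N \<longrightarrow> J \<noteq> {#} \<longrightarrow> size J + 1 \<le> mrank B (\<Union> (set_mset J)))"

lemma dragon_above_add_mset:
  "dragon_above X k (add_mset S N) \<longleftrightarrow> dragon_above X k N \<and> dragon_above (S \<union> X) (Suc k) N"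
  unfolding dragon_above_def subseteq_add_mset_cases by (simp add: ac_simps)

lemma dragon_add_mset: "dragon (add_mset S N) \<longleftrightarrow> dragon N \<and> dragon_above S 2 N"
  unfolding dragon_above_def dragon_def subseteq_add_mset_cases by simp

lemma dragon_above_cong:
  "(\<And>Z. mrank B (X \<union> Z) = mrank B (Y \<union> Z)) \<Longrightarrow> dragon_above X k N \<longleftrightarrow> dragon_above Y k N"
  by (simp add: dragon_above_def)

lemma dragon_above_mono: "\<lbrakk>dragon_above X k N; l \<le> k; X \<subseteq> Y\<rbrakk> \<Longrightarrow> dragon_above Y l N"
  unfolding dragon_above_def by (meson Un_mono add_left_mono le_trans mrank_mono subset_refl)

text \<open>If \<open>J\<close> and \<open>K\<close> violate the bounds for \<open>X\<close> and
  \<open>Y\<close>, the two ranks add up to at most \<open>size J + size K + 2\<close>. The rank of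
  the union is at least \<open>size (J \<union># K) + 3\<close>, that of the intersection at least
  \<open>size (J \<inter># K)\<close>, and submodularity is contradicted. The weaker bound on the
  intersection also covers an empty \<open>J \<inter># K\<close>.\<close>

lemma dragon_above_Un_cases:
  assumes "dragon N" "dragon_above (X \<union> Y) 3 N"
  shows "dragon_above X 2 N \<or> dragon_above Y 2 N"
proof (rule ccontr)
  assume "\<not> ?thesis"
  then obtain J K where J: "J \<subseteq># N" "mrank B (X \<union> \<Union> (set_mset J)) < size J + 2"
    and K: "K \<subseteq># N" "mrank B (Y \<union> \<Union> (set_mset K)) < size K + 2"
    by (auto simp: dragon_above_def not_le)
  let ?X = "X \<union> \<Union> (set_mset J)" and ?Y = "Y \<union> \<Union> (set_mset K)"
  have "J \<union># K \<subseteq># N" using J K by simp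
  then have "size (J \<union># K) + 3 \<le> mrank B (X \<union> Y \<union> \<Union> (set_mset (J \<union># K)))"
    using assms(2) unfolding dragon_above_def by blast
  also have "X \<union> Y \<union> \<Union> (set_mset (J \<union># K)) = ?X \<union> ?Y" by auto
  finally have "size (J \<union># K) + 3 \<le> mrank B (?X \<union> ?Y)" .
  moreover have "size (J \<inter># K) \<le> mrank B (?X \<inter> ?Y)"
  proof (cases "J \<inter># K = {#}")
    case False
    have "J \<inter># K \<subseteq># N" using J by (meson subset_mset.inf_le1 subset_mset.order_trans)
    then have "size (J \<inter># K) + 1 \<le> mrank B (\<Union> (set_mset (J \<inter># K)))"
      using assms(1) False unfolding dragon_def by blast
    also have "\<dots> \<le> mrank B (?X \<inter> ?Y)" by (rule mrank_mono) auto
    finally show ?thesis by simp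
  qed simp
  moreover have "size J + size K = size (J \<union># K) + size (J \<inter># K)" by (rule size_Un_Int)
  ultimately show False using mrank_submodular[of ?X ?Y] J(2) K(2) by linarith
qed

text \<open>\<open>U\<close> is meant to be the closure of \<open>F \<union> F'\<close>, seen only
  through ranks. All bounds involving \<open>U\<close> collapse to bounds over
  \<open>F \<union> F'\<close>, among which the one with 3 implies the one with 2.\<close>

lemma dragon_exchange:
  assumes U: "\<And>Z. mrank B (U \<union> Z) = mrank B (F \<union> F' \<union> Z)"
  shows "of_bool (dragon (add_mset F (add_mset F' N))) + of_bool (dragon (add_mset U (add_mset U N))) =
    (of_bool (dragon (add_mset F (add_mset U N))) + of_bool (dragon (add_mset F' (add_mset U N))) :: real)"
proof -
  let ?Z = "F \<union> F'"
  have absorb: "mrank B (X \<union> U \<union> Z) = mrank B (?Z \<union> Z)" if "X \<subseteq> ?Z \<union> U" for X Z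
  proof -
    have "X \<union> U \<union> Z = U \<union> (X - U \<union> Z)" "?Z \<union> (X - U \<union> Z) = ?Z \<union> Z" using that by auto
    then show ?thesis using U[of "X - U \<union> Z"] by simp
  qed
  have cong: "dragon_above (F \<union> U) k N \<longleftrightarrow> dragon_above ?Z k N"
    "dragon_above (F' \<union> U) k N \<longleftrightarrow> dragon_above ?Z k N"
    "dragon_above (U \<union> U) k N \<longleftrightarrow> dragon_above ?Z k N"
    "dragon_above U k N \<longleftrightarrow> dragon_above ?Z k N" for k
    by (intro dragon_above_cong absorb U; auto)+
  have "dragon_above ?Z 3 N \<Longrightarrow> dragon_above ?Z 2 N" by (erule dragon_above_mono) auto
  moreover note dragon_above_Un_cases[of N F F']
  ultimately show ?thesis
    by (auto simp: dragon_add_mset dragon_above_add_mset cong Un_commute[of F' F] Un_commute[of U]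
        numeral_3_eq_3[symmetric] simp flip: numeral_3_eq_3 numeral_2_eq_2)
qed

section \<open>The functional and the ideal in its kernel\<close>

definition hdeg :: "hpoly \<Rightarrow> real" where
  "hdeg p = (\<Sum>N\<in>Poly_Mapping.keys p. Poly_Mapping.lookup p N * of_bool (size N = d \<and> dragon N))"

lemma hdeg_add: "hdeg (p + q) = hdeg p + hdeg q"
  unfolding hdeg_def by (rule sum_keys_lookup_add) (simp_all add: distrib_right)

lemma hdeg_single: "hdeg (Poly_Mapping.single N c) = c * of_bool (size N = d \<and> dragon N)"
  by (simp add: hdeg_def)

lemma hdeg_0 [simp]: "hdeg 0 = 0"
  by (simp add: hdeg_def)

lemma hdeg_diff: "hdeg (p - q) = hdeg p - hdeg q"
  using hdeg_add[of "p - q" q] by simp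

lemma hdeg_sum: "hdeg (sum f I) = (\<Sum>i\<in>I. hdeg (f i))"
  by (induction I rule: infinite_finite_induct) (simp_all add: hdeg_add)

lemma hdeg_scale: "hdeg (Poly_Mapping.single 0 c * p) = c * hdeg p"
proof -
  have "hdeg (Poly_Mapping.single 0 c * p) =
      (\<Sum>N\<in>Poly_Mapping.keys p. hdeg (Poly_Mapping.single 0 c * Poly_Mapping.single N (Poly_Mapping.lookup p N)))"
    by (subst poly_mapping_eq_sum_single[of p]) (simp only: sum_distrib_left hdeg_sum)
  also have "\<dots> = (\<Sum>N\<in>Poly_Mapping.keys p. c * hdeg (Poly_Mapping.single N (Poly_Mapping.lookup p N)))"
    unfolding mult_single hdeg_single by (simp only: mult.assoc add_0)
  also have "\<dots> = c * hdeg (\<Sum>N\<in>Poly_Mapping.keys p. Poly_Mapping.single N (Poly_Mapping.lookup p N))"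
    by (simp only: sum_distrib_left hdeg_sum)
  finally show ?thesis by (simp only: poly_mapping_eq_sum_single[symmetric])
qed

text \<open>The kernel of \<open>hdeg\<close> is merely a linear subspace; this is the largest ideal
  inside it.\<close>

definition hker :: "hpoly set" where
  "hker = {p. \<forall>r. hdeg (r * p) = 0}"

lemma hkerI:
  assumes "\<And>N c. hdeg (Poly_Mapping.single N c * p) = 0"
  shows "p \<in> hker"
  unfolding hker_def
proof (intro CollectI allI)
  fix r
  show "hdeg (r * p) = 0"
    by (subst poly_mapping_eq_sum_single[of r]) (simp add: sum_distrib_right hdeg_sum assms)
qed

lemma subspace_hker: "ideal.subspace hker"
  by (rule ideal.subspaceI) (simp_all add: hker_def distrib_left hdeg_add mult.assoc[symmetric])

lemmas hker_0 = ideal.subspace_0[OF subspace_hker]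
  and hker_add = ideal.subspace_add[OF subspace_hker]
  and hker_diff = ideal.subspace_diff[OF subspace_hker]
  and hker_mult = ideal.subspace_scale[OF subspace_hker]
  and hker_sum = ideal.subspace_sum[OF subspace_hker]

lemma hdeg_hker: "p \<in> hker \<Longrightarrow> hdeg p = 0"
  unfolding hker_def by (metis (mono_tags, lifting) mem_Collect_eq mult_1)

text \<open>The subfamily consisting of \<open>S\<close> alone already needs rank 2; it is the case
  \<open>J = {#}\<close> of \<open>dragon_above S 2 N\<close>.\<close>

lemma hvar_in_hker: "mrank B S \<le> 1 \<Longrightarrow> hvar S \<in> hker"
proof (rule hkerI)
  fix N c assume "mrank B S \<le> 1"
  then have "\<not> dragon (add_mset S N)"
    by (auto simp: dragon_add_mset dragon_above_def intro!: exI[of _ "{#}"])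
  then show "hdeg (Poly_Mapping.single N c * hvar S) = 0"
    by (simp add: mult_single hdeg_single)
qed

lemma hvar_relation_in_hker:
  assumes U: "\<And>Z. mrank B (U \<union> Z) = mrank B (F \<union> F' \<union> Z)"
  shows "(hvar F - hvar U) * (hvar F' - hvar U) \<in> hker"
proof (rule hkerI)
  fix N c
  have "hdeg (Poly_Mapping.single N c * ((hvar F - hvar U) * (hvar F' - hvar U))) =
    hdeg (Poly_Mapping.single (add_mset F (add_mset F' N)) c) +
    hdeg (Poly_Mapping.single (add_mset U (add_mset U N)) c) -
    (hdeg (Poly_Mapping.single (add_mset F (add_mset U N)) c) +
    hdeg (Poly_Mapping.single (add_mset F' (add_mset U N)) c))"
    by (simp add: hdeg_add[symmetric] hdeg_diff[symmetric] algebra_simps mult_single add_mset_commute)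
  also have "\<dots> = c * of_bool (size N + 2 = d) *
     (of_bool (dragon (add_mset F (add_mset F' N))) + of_bool (dragon (add_mset U (add_mset U N))) -
    (of_bool (dragon (add_mset F (add_mset U N))) + of_bool (dragon (add_mset F' (add_mset U N)))))"
    by (simp add: hdeg_single algebra_simps of_bool_conj)
  also have "\<dots> = 0" using dragon_exchange[OF U, where N = N] by simp
  finally show "hdeg (Poly_Mapping.single N c * ((hvar F - hvar U) * (hvar F' - hvar U))) = 0" .
qed

lemma mrank_UN_cl:
  assumes "finite J" "\<And>j. j \<in> J \<Longrightarrow> A j \<subseteq> E"
  shows "mrank B ((\<Union>j\<in>J. cl (A j)) \<union> X) = mrank B ((\<Union>j\<in>J. A j) \<union> X)"
  using assms
proof (induction arbitrary: X rule: finite_induct)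
  case (insert j J)
  have "mrank B ((\<Union>j\<in>insert j J. cl (A j)) \<union> X) = mrank B ((\<Union>j\<in>J. cl (A j)) \<union> (cl (A j) \<union> X))"
    by (simp add: ac_simps)
  also have "\<dots> = mrank B ((\<Union>j\<in>J. A j) \<union> (cl (A j) \<union> X))" using insert by auto
  also have "\<dots> = mrank B (cl (A j) \<union> ((\<Union>j\<in>J. A j) \<union> X))" by (simp add: ac_simps)
  also have "\<dots> = mrank B (A j \<union> ((\<Union>j\<in>J. A j) \<union> X))" using insert by (intro mrank_cl_Un) auto
  finally show ?case by (simp add: ac_simps)
qed simp

text \<open>Closures appear because the substitution below sends \<open>h S\<close> to the variable
  of \<open>cl S\<close>, up to a correction. Ranks of unions do not notice them. Since closures may
  coincide for different indices, submultisets have to be lifted to sets of indices.\<close>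

lemma dragon_image_mset_iff_DHR:
  assumes "\<forall>j\<in>{1..d}. A j \<subseteq> E"
  shows "dragon (image_mset (\<lambda>j. cl (A j)) (mset_set {1..d})) \<longleftrightarrow> DHR B A d"
proof -
  have rank: "mrank B (\<Union>j\<in>J. cl (A j)) = mrank B (\<Union>j\<in>J. A j)" if "J \<subseteq> {1..d}" for J
    using mrank_UN_cl[of J A "{}"] that assms finite_subset[OF that] by auto
  show ?thesis
  proof
    assume L: "dragon (image_mset (\<lambda>j. cl (A j)) (mset_set {1..d}))"
    show "DHR B A d"
      unfolding DHR_def
    proof (intro allI impI)
      fix J assume J: "J \<subseteq> {1..d} \<and> J \<noteq> {}"
      then have fin: "finite J" using finite_subset by blast
      let ?J = "image_mset (\<lambda>j. cl (A j)) (mset_set J)"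
      have "?J \<subseteq># image_mset (\<lambda>j. cl (A j)) (mset_set {1..d})"
        using J by (intro image_mset_subseteq_mono) (simp add: subset_imp_msubset_mset_set)
      moreover have "?J \<noteq> {#}" using J fin by (simp add: mset_set_empty_iff)
      ultimately have "size ?J + 1 \<le> mrank B (\<Union> (set_mset ?J))"
        using L unfolding dragon_def by blast
      then show "card J + 1 \<le> mrank B (\<Union>j\<in>J. A j)" using fin J rank[of J] by simp
    qed
  next
    assume R: "DHR B A d"
    show "dragon (image_mset (\<lambda>j. cl (A j)) (mset_set {1..d}))"
      unfolding dragon_def
    proof (intro allI impI)
      fix J assume J: "J \<subseteq># image_mset (\<lambda>j. cl (A j)) (mset_set {1..d})" "J \<noteq> {#}"
      then obtain M where M: "M \<subseteq># mset_set {1..d}" "J = image_mset (\<lambda>j. cl (A j)) M"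
        by (metis image_mset_eq_plusD mset_subset_eq_exists_conv mset_subset_eq_add_left)
      \<comment> \<open>Indices have multiplicity at most 1, so the lifted multiset is a set, to
        which DHR applies.\<close>
      have M_set: "M = mset_set (set_mset M)"
      proof (rule multiset_eqI)
        fix x
        have "count M x \<le> count (mset_set {1..d}) x" using M(1) by (rule mset_subset_eq_count)
        also have "\<dots> \<le> 1" by (simp add: count_mset_set')
        finally have "count M x \<le> 1" .
        then show "count M x = count (mset_set (set_mset M)) x"
          by (cases "x \<in># M") (simp_all add: count_mset_set' not_in_iff le_antisym)
      qed
      have sub: "set_mset M \<subseteq> {1..d}" using set_mset_mono[OF M(1)] by simp
      have "set_mset M \<noteq> {}" using J(2) M(2) by auto
      then have "card (set_mset M) + 1 \<le> mrank B (\<Union>j\<in>set_mset M. A j)" using R sub by (simp add: DHR_def)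
      moreover have "size M = card (set_mset M)" by (subst M_set) simp
      ultimately show "size J + 1 \<le> mrank B (\<Union> (set_mset J))" using M(2) rank[OF sub] by simp
    qed
  qed
qed

end

section \<open>The degree map\<close>

context chow_matroid
begin

section \<open>The x-variables expressed in the h-variables\<close>

text \<open>The equations h_F = - (sum of z_G over flats G \<supseteq> F) solved for the
  Feichtner-Yuzvinsky variables. The top variable z_E = - \<alpha> takes part, so the inversion runs
  over the whole lattice of flats.\<close>

definition h_subst :: "nat set \<Rightarrow> hpoly" where
  "h_subst = (SOME p. \<forall>F\<in>{F. is_flat E B F}. (\<Sum>G\<in>{G \<in> {F. is_flat E B F}. F \<subseteq> G}. p G) = - hvar F)"

lemma sum_h_subst_flat:
  "is_flat E B F \<Longrightarrow> (\<Sum>G\<in>{G. is_flat E B G \<and> F \<subseteq> G}. h_subst G) = - hvar F"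
  using someI_ex[OF zeta_inversion[OF finite_flats, of "\<lambda>F. - hvar F"]]
  by (simp add: h_subst_def)

lemma sum_h_subst:
  assumes "S \<subseteq> E"
  shows "(\<Sum>G\<in>{G. is_flat E B G \<and> S \<subseteq> G}. h_subst G) = - hvar (cl S)"
proof -
  have "{G. is_flat E B G \<and> S \<subseteq> G} = {G. is_flat E B G \<and> cl S \<subseteq> G}"
    using cl_subset_flat_iff[OF _ assms] by (intro Collect_cong) blast
  then show ?thesis using sum_h_subst_flat[OF flat_cl[OF assms]] by (simp only:)
qed

lemma sum_h_subst_proper:
  assumes "S \<subseteq> E"
  shows "(\<Sum>G\<in>{G. is_flat E B G \<and> G \<noteq> E \<and> S \<subseteq> G}. h_subst G) = hvar E - hvar (cl S)"
proof -
  have "{G. is_flat E B G \<and> E \<subseteq> G} = {E}" using flat_E flat_subset by auto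
  then have E: "h_subst E = - hvar E" using sum_h_subst_flat[OF flat_E] by simp
  have "{G. is_flat E B G \<and> S \<subseteq> G} = insert E {G. is_flat E B G \<and> G \<noteq> E \<and> S \<subseteq> G}"
    using assms flat_E by auto
  moreover have "finite {G. is_flat E B G \<and> G \<noteq> E \<and> S \<subseteq> G}"
    using finite_flats by (rule rev_finite_subset) auto
  ultimately have "- hvar (cl S) = h_subst E + (\<Sum>G\<in>{G. is_flat E B G \<and> G \<noteq> E \<and> S \<subseteq> G}. h_subst G)"
    using sum_h_subst[OF assms] by simp
  then show ?thesis by (simp add: E algebra_simps)
qed

abbreviation ev :: "cpoly \<Rightarrow> hpoly" where
  "ev \<equiv> poly_subst h_subst"

lemma ev_chow_alpha: "i \<in> E \<Longrightarrow> ev (chow_alpha E B i) = hvar E - hvar (cl {i})"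
proof -
  assume i: "i \<in> E"
  have "{F \<in> proper_flats E B. i \<in> F} = {G. is_flat E B G \<and> G \<noteq> E \<and> {i} \<subseteq> G}"
    by (auto simp: proper_flats_def)
  then have "ev (chow_alpha E B i) = (\<Sum>G\<in>{G. is_flat E B G \<and> G \<noteq> E \<and> {i} \<subseteq> G}. h_subst G)"
    by (simp only: chow_alpha_def poly_subst_sum poly_subst_xvar)
  then show ?thesis using sum_h_subst_proper[of "{i}"] i by simp
qed

text \<open>The correction \<open>hvar (cl {0})\<close> comes from expanding \<alpha> at the point
  0; as the variable of a rank 1 flat it lies in \<open>hker\<close>.\<close>

lemma ev_h: "S \<subseteq> E \<Longrightarrow> ev (h S) = hvar (cl S) - hvar (cl {0})"
  unfolding h_class_def
  by (simp add: poly_subst_diff poly_subst_sum poly_subst_xvar ev_chow_alpha zero_in_E sum_h_subst_proper)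

lemma hvar_cl_singleton_in_hker: "i \<in> E \<Longrightarrow> hvar (cl {i}) \<in> hker"
  by (rule hvar_in_hker) (simp add: mrank_cl mrank_singleton)

text \<open>Expand \<open>(hvar F - hvar U) * (hvar F' - hvar U)\<close>, a member of
  \<open>hker\<close>, over pairs of flats above \<open>F\<close> and \<open>F'\<close> that do not
  contain \<open>F \<union> F'\<close>. All these pairs are incomparable, and every pair but
  \<open>(F, F')\<close> is strictly larger in a component, so the induction descends from the top
  of the lattice.\<close>

lemma h_subst_incomparable_in_hker:
  "\<lbrakk>is_flat E B F; is_flat E B F'; \<not> F \<subseteq> F'; \<not> F' \<subseteq> F\<rbrakk> \<Longrightarrow> h_subst F * h_subst F' \<in> hker"
proof (induction "card (E - F) + card (E - F')" arbitrary: F F' rule: less_induct)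
  case less
  define U where "U = cl (F \<union> F')"
  define X where "X S = {G. is_flat E B G \<and> S \<subseteq> G}" for S
  have fin: "finite (X S)" for S
    using finite_flats by (rule rev_finite_subset) (auto simp: X_def)
  have FE: "F \<subseteq> E" "F' \<subseteq> E" using less.prems flat_subset by auto
  have diff: "(\<Sum>G\<in>X H - X (F \<union> F'). h_subst G) = - (hvar H - hvar U)"
    if "is_flat E B H" "H \<subseteq> F \<union> F'" for H
  proof -
    have "X (F \<union> F') \<subseteq> X H" using that by (auto simp: X_def)
    then have "(\<Sum>G\<in>X H - X (F \<union> F'). h_subst G) = (\<Sum>G\<in>X H. h_subst G) - (\<Sum>G\<in>X (F \<union> F'). h_subst G)"
      using fin by (intro sum_diff)
    also have "(\<Sum>G\<in>X H. h_subst G) = - hvar H"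
      unfolding X_def by (rule sum_h_subst_flat[OF that(1)])
    also have "(\<Sum>G\<in>X (F \<union> F'). h_subst G) = - hvar U"
      unfolding X_def U_def using FE by (intro sum_h_subst) auto
    finally show ?thesis by simp
  qed
  let ?P = "(X F - X (F \<union> F')) \<times> (X F' - X (F \<union> F'))"
  have "(hvar F - hvar U) * (hvar F' - hvar U) =
      (\<Sum>G\<in>X F - X (F \<union> F'). h_subst G) * (\<Sum>G\<in>X F' - X (F \<union> F'). h_subst G)"
    using less.prems by (simp add: diff algebra_simps)
  also have "\<dots> = (\<Sum>(G, G')\<in>?P. h_subst G * h_subst G')"
    by (simp add: sum_product sum.cartesian_product)
  also have "\<dots> = h_subst F * h_subst F' + (\<Sum>(G, G')\<in>?P - {(F, F')}. h_subst G * h_subst G')"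
  proof (subst sum.remove)
    show "finite ?P" using fin by auto
    show "(F, F') \<in> ?P" using less.prems by (auto simp: X_def)
  qed simp
  finally have "h_subst F * h_subst F' = (hvar F - hvar U) * (hvar F' - hvar U) -
      (\<Sum>(G, G')\<in>?P - {(F, F')}. h_subst G * h_subst G')"
    by simp
  moreover have "(hvar F - hvar U) * (hvar F' - hvar U) \<in> hker"
    using FE by (intro hvar_relation_in_hker) (simp add: U_def mrank_cl_Un)
  moreover have "(\<Sum>(G, G')\<in>?P - {(F, F')}. h_subst G * h_subst G') \<in> hker"
  proof (rule hker_sum)
    fix GG assume "GG \<in> ?P - {(F, F')}"
    then obtain G G' where GG: "GG = (G, G')" and G: "G \<in> X F - X (F \<union> F')" "G' \<in> X F' - X (F \<union> F')"
      and ne: "(G, G') \<noteq> (F, F')" by auto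
    have flats: "is_flat E B G" "is_flat E B G'" "F \<subseteq> G" "F' \<subseteq> G'" "\<not> G \<subseteq> G'" "\<not> G' \<subseteq> G"
      using G by (auto simp: X_def)
    have le: "card (E - G) \<le> card (E - F)" "card (E - G') \<le> card (E - F')"
      using flats(3,4) finite_E by (auto intro!: card_mono)
    have lt: "card (E - K) < card (E - H)" if "H \<subseteq> K" "H \<noteq> K" "K \<subseteq> E" for H K
      using that finite_E by (intro psubset_card_mono) auto
    have "card (E - G) + card (E - G') < card (E - F) + card (E - F')"
    proof (cases "G = F")
      case True
      then have "card (E - G') < card (E - F')"
        using ne flats flat_subset by (intro lt) auto
      with le show ?thesis by linarith
    next
      case False
      then have "card (E - G) < card (E - F)" using flats flat_subset by (intro lt) auto
      with le show ?thesis by linarith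
    qed
    then show "(case GG of (G, G') \<Rightarrow> h_subst G * h_subst G') \<in> hker"
      unfolding GG using flats by (simp add: less.hyps)
  qed
  ultimately show ?case by (simp add: hker_diff)
qed

text \<open>The preimage of an ideal under the ring homomorphism \<open>ev\<close> is an ideal, so
  the generators suffice.\<close>

lemma ev_chow_ideal: "p \<in> chow_ideal E B \<Longrightarrow> ev p \<in> hker"
proof -
  have "ideal.subspace {p. ev p \<in> hker}"
    by (rule ideal.subspaceI) (simp_all add: hker_0 poly_subst_add poly_subst_mult hker_add hker_mult)
  moreover have "ev (chow_alpha E B i - chow_alpha E B j) \<in> hker" if "i \<in> E" "j \<in> E" for i j
    using hker_diff[OF hvar_cl_singleton_in_hker[OF that(2)] hvar_cl_singleton_in_hker[OF that(1)]]
    by (simp add: poly_subst_diff ev_chow_alpha that)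
  moreover have "ev (xvar F * xvar F') \<in> hker"
    if "F \<in> proper_flats E B" "F' \<in> proper_flats E B" "\<not> F \<subseteq> F'" "\<not> F' \<subseteq> F" for F F'
    using that by (simp add: poly_subst_mult poly_subst_xvar proper_flats_def h_subst_incomparable_in_hker)
  ultimately have "chow_ideal E B \<subseteq> {p. ev p \<in> hker}"
    unfolding chow_ideal_def ideal_gen_eq_span chow_alpha_def[symmetric]
    by (intro ideal.span_minimal Un_least; blast)
  then show "p \<in> chow_ideal E B \<Longrightarrow> ev p \<in> hker" by blast
qed

lemma hdeg_ev_cong: "p \<approx> q \<Longrightarrow> hdeg (ev p) = hdeg (ev q)"
  using hdeg_hker[OF ev_chow_ideal, of "p - q"] by (simp add: chow_eq_def poly_subst_diff hdeg_diff)

lemma hdeg_ev_scale: "hdeg (ev (Poly_Mapping.single 0 c * p)) = c * hdeg (ev p)"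
  by (simp add: poly_subst_mult poly_subst_single hdeg_scale)

section \<open>Evaluation of the degree\<close>

lemma hdeg_ev_prod_h:
  assumes A: "\<forall>j\<in>{1..d}. A j \<subseteq> E"
  shows "hdeg (ev (\<Prod>j\<in>{1..d}. h (A j))) = of_bool (DHR B A d)"
proof -
  let ?v = "hvar (cl {0})"
  \<comment> \<open>Dropping the corrections \<open>?v\<close> factor by factor changes the product
    only by elements of \<open>hker\<close>.\<close>
  have "(\<Prod>j\<in>I. hvar (cl (A j)) - ?v) - (\<Prod>j\<in>I. hvar (cl (A j))) \<in> hker" if "finite I" for I :: "nat set"
    using that
  proof (induction rule: finite_induct)
    case (insert i I)
    let ?a = "\<Prod>j\<in>I. hvar (cl (A j)) - ?v" and ?b = "\<Prod>j\<in>I. hvar (cl (A j))"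
    have "hvar (cl (A i)) * (?a - ?b) - ?a * ?v \<in> hker"
      using insert.IH zero_in_E by (intro hker_diff[OF hker_mult hker_mult] hvar_cl_singleton_in_hker)
    moreover have "(\<Prod>j\<in>insert i I. hvar (cl (A j)) - ?v) - (\<Prod>j\<in>insert i I. hvar (cl (A j))) =
        hvar (cl (A i)) * (?a - ?b) - ?a * ?v"
      unfolding prod.insert[OF insert.hyps] by (simp only: algebra_simps)
    ultimately show ?case by (simp only:)
  qed (simp add: hker_0)
  then have "hdeg (\<Prod>j\<in>{1..d}. hvar (cl (A j)) - ?v) = hdeg (\<Prod>j\<in>{1..d}. hvar (cl (A j)))"
    using hdeg_hker[of "(\<Prod>j\<in>{1..d}. hvar (cl (A j)) - ?v) - (\<Prod>j\<in>{1..d}. hvar (cl (A j)))"]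
    by (simp add: hdeg_diff)
  moreover have "ev (\<Prod>j\<in>{1..d}. h (A j)) = (\<Prod>j\<in>{1..d}. hvar (cl (A j)) - ?v)"
    unfolding poly_subst_prod using A by (intro prod.cong) (auto simp: ev_h)
  moreover have "(\<Prod>j\<in>{1..d}. hvar (cl (A j))) =
      Poly_Mapping.single (image_mset (\<lambda>j. cl (A j)) (mset_set {1..d})) 1"
    unfolding prod_single by (simp add: sum_unfold_sum_mset)
  ultimately show ?thesis
    using dragon_image_mset_iff_DHR[OF A] by (simp add: hdeg_single)
qed

text \<open>The constant family \<open>E\<close> satisfies DHR because
  \<open>card J \<le> d\<close>. Hence \<open>alpha ^ d\<close> is nonzero in the Chow ring.\<close>

lemma hdeg_ev_alpha_power: "hdeg (ev (alpha ^ d)) = 1"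
proof -
  have "DHR B (\<lambda>_. E) d"
    unfolding DHR_def
  proof (intro allI impI)
    fix J assume J: "J \<subseteq> {1..d} \<and> J \<noteq> {}"
    then have "(\<Union>j\<in>J. E) = E" by auto
    then show "card J + 1 \<le> mrank B (\<Union>j\<in>J. E)"
      using J card_mono[of "{1..d}" J] mrank_E by simp
  qed
  then show ?thesis using hdeg_ev_prod_h[of "\<lambda>_. E"] by (simp add: h_E)
qed

text \<open>Straightening provides a value for the definite description; \<open>hdeg\<close> gives
  its uniqueness and identifies it.\<close>

theorem chow_degree_prod_h:
  assumes A: "\<forall>j\<in>{1..d}. A j \<noteq> {} \<and> A j \<subseteq> E"
  shows "chow_degree E B (\<Prod>j\<in>{1..d}. h (A j)) = of_bool (DHR B A d)"
proof -
  let ?p = "\<Prod>j\<in>{1..d}. h (A j)"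
  obtain c where "?p \<approx> Poly_Mapping.single 0 c * h E ^ card {1..d}"
    using prod_h_eq_multiple_power[of "{1..d}" E A] A zero_in_E mrank_E by auto
  then have c: "?p \<approx> Poly_Mapping.single 0 c * alpha ^ d" by (simp add: h_E)
  have "of_bool (DHR B A d) = c"
    using hdeg_ev_cong[OF c] hdeg_ev_prod_h[of A] A by (simp add: hdeg_ev_scale hdeg_ev_alpha_power)
  moreover have "chow_degree E B ?p = c"
    unfolding chow_degree_def chow_eq_def[symmetric]
  proof (rule the_equality)
    show "\<forall>C. maximal_flat_chain E B C \<longrightarrow> ?p \<approx> Poly_Mapping.single 0 c * (\<Prod>F\<in>C. xvar F)"
      using c alpha_power_eq_maximal_chain by (blast intro: chow_eq_trans chow_eq_mult_left)
  next
    fix c' assume c': "\<forall>C. maximal_flat_chain E B C \<longrightarrow> ?p \<approx> Poly_Mapping.single 0 c' * (\<Prod>F\<in>C. xvar F)"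
    \<comment> \<open>Without a maximal chain the condition on \<open>c'\<close> would be vacuous
      and uniqueness would fail.\<close>
    obtain C where C: "maximal_flat_chain E B C" using exists_maximal_flat_chain by blast
    have "?p \<approx> Poly_Mapping.single 0 c' * (\<Prod>F\<in>C. xvar F)" using c' C by blast
    moreover have "hdeg (ev (\<Prod>F\<in>C. xvar F)) = 1"
      using hdeg_ev_cong[OF alpha_power_eq_maximal_chain[OF C]] hdeg_ev_alpha_power by simp
    ultimately show "c' = c"
      using hdeg_ev_cong[OF c] by (simp add: hdeg_ev_cong hdeg_ev_scale hdeg_ev_alpha_power)
  qed
  ultimately show ?thesis by simp
qed

end

theorem theorem5p10:
  fixes n d :: nat and B :: "nat set set" and A :: "nat \<Rightarrow> nat set"
  assumes "matroid_bases {0..n} B"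
    and "loopless {0..n} B"
    and "\<forall>b\<in>B. card b = d + 1"
    and "\<forall>i\<in>{1..d}. A i \<noteq> {} \<and> A i \<subseteq> {0..n}"
  shows "(iter_wedge_sp {0..n} B A d = spanning_sets {0..n} (U1_bases {0..n}) \<longleftrightarrow> DHR B A d)
     \<and> chow_degree {0..n} B (\<Prod>i\<in>{1..d}. h_class {0..n} B (A i)) = (if DHR B A d then 1 else 0)"
proof -
  interpret chow_matroid "{0..n}" B d
    using assms by unfold_locales auto
  show ?thesis
    using wedge_eq_U1_iff_DHR[OF assms(4)] chow_degree_prod_h[OF assms(4)] by simp
qed

end
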